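(* The number $1$ is an accumulation point of the set $\{\omega(G) : G \text{ is a finitely generated elementary amenable group}\}\subseteq[1,\infty)$.
   Context: For a group $G$ generated by a finite set $X$, $\|g\|_X$ denotes the length of a shortest word over $X\cup X^{-1}$ representing $g\in G$, and $\gamma_G^X(n)=\mathrm{card}\{g\in G : \|g\|_X\le n\}$. The exponential growth rate of $G$ with respect to $X$ is $\omega(G,X)=\lim_{n\to\infty}\sqrt[n]{\gamma_G^X(n)}$ (the limit exists). The minimal exponential growth rate is $\omega(G)=\inf_X\omega(G,X)$, the infimum over all finite generating sets $X$ of $G$. The class $EG$ of elementary amenable groups is the smallest class of groups that contains all abelian groups and all finite groups and is closed under taking subgroups, quotient groups, group extensions, and direct limits in the sense of directed unions (i.e. if $\{G_\lambda\}_{\lambda\in\Lambda}$ is a family of groups in the class such that for all $\lambda,\mu\in\Lambda$ there is $\nu\in\Lambda$ with $G_\lambda\cup G_\mu\subseteq G_\nu$ as subgroups, then $\bigcup_{\lambda\in\Lambda}G_\lambda$ is in the class). *)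

theory Defs
  imports "HOL-Algebra.Generated_Groups" "HOL-Analysis.Analysis"
begin

definition finite_generating_set :: "('a, 'b) monoid_scheme \<Rightarrow> 'a set \<Rightarrow> bool" where
  "finite_generating_set G X \<longleftrightarrow> finite X \<and> X \<subseteq> carrier G \<and> generate G X = carrier G"

definition finitely_generated_group :: "('a, 'b) monoid_scheme \<Rightarrow> bool" where
  "finitely_generated_group G \<longleftrightarrow> group G \<and> (\<exists>X. finite_generating_set G X)"

definition word_product :: "('a, 'b) monoid_scheme \<Rightarrow> 'a list \<Rightarrow> 'a" where
  "word_product G w = foldr (\<lambda>x y. x \<otimes>\<^bsub>G\<^esub> y) w \<one>\<^bsub>G\<^esub>"

definition word_length :: "('a, 'b) monoid_scheme \<Rightarrow> 'a set \<Rightarrow> 'a \<Rightarrow> nat" where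
  "word_length G X g =
     (LEAST n. \<exists>w. set w \<subseteq> X \<union> m_inv G ` X \<and> length w = n \<and> word_product G w = g)"

definition growth_function :: "('a, 'b) monoid_scheme \<Rightarrow> 'a set \<Rightarrow> nat \<Rightarrow> nat" where
  "growth_function G X n = card {g \<in> carrier G. word_length G X g \<le> n}"

text \<open>The limit below exists whenever \<open>X\<close> is a finite generating set of a group \<open>G\<close>, since the
  growth function is then submultiplicative; only such \<open>X\<close> are used.\<close>

definition growth_rate :: "('a, 'b) monoid_scheme \<Rightarrow> 'a set \<Rightarrow> real" where
  "growth_rate G X = lim (\<lambda>n. root n (real (growth_function G X n)))"

definition minimal_growth_rate :: "('a, 'b) monoid_scheme \<Rightarrow> real" where
  "minimal_growth_rate G = (INF X \<in> {X. finite_generating_set G X}. growth_rate G X)"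

text \<open>The class of elementary amenable groups, among groups whose carrier is a set of elements
  of \<open>'a\<close>. Since \<open>G Mod N\<close> has carrier type \<open>'a set\<close>, quotients enter through isomorphic copies on
  \<open>'a\<close>; such copies always exist, because the quotient is no larger than the group. Taking
  \<open>N\<close> trivial in the rule \<open>quotient\<close> shows that the class is closed under isomorphism.

  For infinite \<open>'a\<close>, working on a single type does not shrink the class: the groups (of any size)
  all of whose subgroups embeddable into \<open>'a\<close> have a copy in the class below contain the finite
  and the abelian groups and are closed under the four operations.\<close>

inductive elementary_amenable :: "'a monoid \<Rightarrow> bool" where
  abelian: "comm_group G \<Longrightarrow> elementary_amenable G"
| finite: "group G \<Longrightarrow> finite (carrier G) \<Longrightarrow> elementary_amenable G"
| subgroup: "elementary_amenable G \<Longrightarrow> subgroup H G \<Longrightarrow> elementary_amenable (G\<lparr>carrier := H\<rparr>)"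
| quotient: "elementary_amenable G \<Longrightarrow> N \<lhd> G \<Longrightarrow> group Q \<Longrightarrow> G Mod N \<cong> Q
    \<Longrightarrow> elementary_amenable Q"
| extension: "group G \<Longrightarrow> N \<lhd> G \<Longrightarrow> elementary_amenable (G\<lparr>carrier := N\<rparr>)
    \<Longrightarrow> elementary_amenable Q \<Longrightarrow> G Mod N \<cong> Q \<Longrightarrow> elementary_amenable G"
| directed_union: "group G
    \<Longrightarrow> (\<forall>H \<in> \<H>. subgroup H G \<and> elementary_amenable (G\<lparr>carrier := H\<rparr>))
    \<Longrightarrow> (\<forall>H \<in> \<H>. \<forall>K \<in> \<H>. \<exists>L \<in> \<H>. H \<union> K \<subseteq> L)
    \<Longrightarrow> carrier G = \<Union>\<H> \<Longrightarrow> elementary_amenable G"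

text \<open>For infinite \<open>'a\<close>, every finitely generated group, being countable, has an isomorphic copy
  on \<open>'a\<close>, so this is the set of rates of all finitely generated elementary amenable groups.\<close>

definition EG_growth_rates :: "'a itself \<Rightarrow> real set" where
  "EG_growth_rates _ =
     {minimal_growth_rate G | G :: 'a monoid. finitely_generated_group G \<and> elementary_amenable G}"

end

theory Submission
  imports Defs "HOL-Algebra.Weak_Morphisms" "HOL-Algebra.Elementary_Groups"
begin

text \<open>The construction is Grigorchuk's, truncated after finitely many steps. If \<open>G\<close> is generated by
  \<open>a\<close>, \<open>b\<close>, \<open>c\<close>, \<open>d\<close> with \<open>a\<^sup>2 = b\<^sup>2 = c\<^sup>2 = 1\<close> and \<open>bc = cb = d\<close>, then so is the subgroup of
  the wreath product of \<open>G\<close> by \<open>\<int>/2\<close> generated by the swap, \<open>(a, c)\<close>, \<open>(a, d)\<close>, \<open>(1, b)\<close>. For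
  suitable weights of the letters, the two coordinates of an element of weight \<open>n\<close> have total weight
  at most \<open>6/7 n + O(1)\<close>, so a growth rate \<open>r > 1\<close> drops to at most \<open>r\<^bsup>9/10\<^esup>\<close>. Iteration sends the rate to
  \<open>1\<close>, and elementary amenability persists.

  The minimal rate stays above \<open>1\<close>: the index two subgroup of the new group that does not swap the
  coordinates projects onto \<open>G\<close>, so by Schreier's argument uniform exponential growth is inherited.
  The initial group is generated inside the wreath product of \<open>\<int>/2\<close> by the isometries of \<open>\<int>\<close>; in
  its index two lamplighter group, a translation \<open>x\<close> from any generating set and a nontrivial
  commutator \<open>u = [x, y]\<close> give a free semigroup on \<open>x\<close> and \<open>u x\<close>.\<close>

section \<open>Growth of groups\<close>

text \<open>Fekete's lemma: \<open>f n = ln (a n)\<close> is subadditive, so \<open>f n / n\<close>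
  converges to its infimum \<open>L\<close>, as one sees by dividing \<open>n\<close> with remainder
  by some \<open>m\<close> for which the quotient is nearly \<open>L\<close>.\<close>

lemma submultiplicative_root_convergent:
  fixes a :: "nat \<Rightarrow> real"
  assumes ge1: "\<And>n. 1 \<le> a n" and submult: "\<And>m n. a (m + n) \<le> a m * a n"
  shows "convergent (\<lambda>n. root n (a n))"
proof -
  define f where "f n = ln (a n)" for n
  have f_nonneg: "0 \<le> f n" for n using ge1[of n] by (simp add: f_def)
  have apos: "0 < a n" for n using ge1[of n] by linarith
  have f_add: "f (m + n) \<le> f m + f n" for m n
  proof -
    have "f (m + n) \<le> ln (a m * a n)"
      unfolding f_def using submult[of m n] apos by (simp add: ln_le_cancel_iff)
    thus ?thesis unfolding f_def using apos[of m] apos[of n] by (simp add: ln_mult)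
  qed
  have f_mult: "f (q * m + r) \<le> real q * f m + f r" for q m r
  proof (induction q)
    case (Suc q)
    have "f (Suc q * m + r) \<le> f m + f (q * m + r)"
      using f_add[of m "q * m + r"] by (simp add: algebra_simps)
    with Suc show ?case by (simp add: algebra_simps)
  qed simp
  define L where "L = (INF n\<in>{1..}. f n / real n)"
  have bdd: "bdd_below ((\<lambda>n. f n / real n) ` {1..})"
    by (rule bdd_belowI[of _ 0]) (use f_nonneg in auto)
  have L_le: "L \<le> f n / real n" if "1 \<le> n" for n
    unfolding L_def by (rule cINF_lower[OF bdd]) (use that in auto)
  have "(\<lambda>n. f n / real n) \<longlonglongrightarrow> L"
  proof (rule LIMSEQ_I)
    fix e :: real assume e: "0 < e"
    have "\<exists>m\<in>{1..}. f m / real m < L + e / 2"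
      using cINF_less_iff[OF _ bdd, of "L + e / 2"] e unfolding L_def by auto
    then obtain m where m: "1 \<le> m" "f m / real m < L + e / 2" by auto
    \<comment> \<open>\<open>B\<close> bounds what the remainder modulo \<open>m\<close>
      contributes; after division by a large \<open>n\<close> it is less than
      \<open>e / 2\<close>.\<close>
    define B where "B = Max (f ` {..<m})"
    have B: "f r \<le> B" if "r < m" for r
      unfolding B_def by (rule Max_ge) (use that in auto)
    have B0: "0 \<le> B" using B[of 0] f_nonneg[of 0] m by linarith
    obtain N :: nat where N: "2 * B / e < real N" using reals_Archimedean2 by blast
    show "\<exists>no. \<forall>n\<ge>no. norm (f n / real n - L) < e"
    proof (intro exI allI impI)
      fix n assume n: "Suc N \<le> n"
      have npos: "0 < real n" using n by simp
      have "f n \<le> real (n div m) * f m + f (n mod m)"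
        using f_mult[of "n div m" m "n mod m"] by simp
      also have "\<dots> \<le> real (n div m) * f m + B" using B[of "n mod m"] m by simp
      also have "real (n div m) * f m = real (n div m * m) * (f m / real m)" using m by simp
      also have "\<dots> \<le> real n * (f m / real m)"
        by (rule mult_right_mono) (use f_nonneg[of m] in \<open>auto simp del: of_nat_mult\<close>)
      finally have "f n \<le> real n * (f m / real m) + B" by simp
      hence "f n / real n \<le> f m / real m + B / real n"
        using npos by (simp add: field_simps)
      moreover have "B / real n < e / 2"
      proof -
        have "2 * B / e < real n" using N n by linarith
        thus ?thesis using e npos by (simp add: field_simps)
      qed
      ultimately have "f n / real n < L + e" using m(2) by linarith
      moreover have "L \<le> f n / real n" using L_le n by simp
      ultimately show "norm (f n / real n - L) < e" by simp
    qed
  qed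
  hence "(\<lambda>n. exp (f n / real n)) \<longlonglongrightarrow> exp L" by (rule tendsto_exp)
  \<comment> \<open>At \<open>n = 0\<close> the conventions for division and \<open>root\<close>
    give 1 and 0, so the two sequences agree only from 1 on.\<close>
  moreover have "\<forall>\<^sub>F n in sequentially. exp (f n / real n) = root n (a n)"
  proof (rule eventually_sequentiallyI[of 1])
    fix n :: nat assume n: "1 \<le> n"
    show "exp (f n / real n) = root n (a n)"
      using n apos[of n] by (simp add: f_def root_powr_inverse powr_def)
  qed
  ultimately have "(\<lambda>n. root n (a n)) \<longlonglongrightarrow> exp L" by (rule Lim_transform_eventually)
  thus ?thesis by (auto simp: convergent_def)
qed

section \<open>Balls in the word metric\<close>

definition word_ball :: "('a, 'b) monoid_scheme \<Rightarrow> 'a set \<Rightarrow> nat \<Rightarrow> 'a set" where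
  "word_ball G X n = word_product G ` {w. set w \<subseteq> X \<union> m_inv G ` X \<and> length w \<le> n}"

lemma word_product_Nil [simp]: "word_product G [] = \<one>\<^bsub>G\<^esub>"
  by (simp add: word_product_def)

lemma word_product_Cons [simp]: "word_product G (x # w) = x \<otimes>\<^bsub>G\<^esub> word_product G w"
  by (simp add: word_product_def)

context group
begin

lemma word_product_closed: "set w \<subseteq> carrier G \<Longrightarrow> word_product G w \<in> carrier G"
  by (induction w) auto

lemma word_product_append:
  "set v \<subseteq> carrier G \<Longrightarrow> set w \<subseteq> carrier G \<Longrightarrow>
    word_product G (v @ w) = word_product G v \<otimes> word_product G w"
  by (induction v) (auto simp: m_assoc word_product_closed)

lemma letters_subset: "X \<subseteq> carrier G \<Longrightarrow> X \<union> m_inv G ` X \<subseteq> carrier G"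
  by auto

lemma word_ball_subset: "X \<subseteq> carrier G \<Longrightarrow> word_ball G X n \<subseteq> carrier G"
  unfolding word_ball_def by (auto intro!: word_product_closed dest: subset_trans[OF _ letters_subset])

lemma one_in_word_ball: "\<one> \<in> word_ball G X n"
  unfolding word_ball_def by (rule image_eqI[of _ _ "[]"]) auto

lemma incl_word_ball: "X \<subseteq> carrier G \<Longrightarrow> x \<in> X \<Longrightarrow> 0 < n \<Longrightarrow> x \<in> word_ball G X n"
  unfolding word_ball_def by (rule image_eqI[of _ _ "[x]"]) (auto)

lemma word_ball_mono: "m \<le> n \<Longrightarrow> word_ball G X m \<subseteq> word_ball G X n"
  unfolding word_ball_def by auto

lemma word_ball_mult:
  assumes "X \<subseteq> carrier G" "g \<in> word_ball G X m" "h \<in> word_ball G X n"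
  shows "g \<otimes> h \<in> word_ball G X (m + n)"
proof -
  obtain v w where v: "set v \<subseteq> X \<union> m_inv G ` X" "length v \<le> m" "g = word_product G v"
    and w: "set w \<subseteq> X \<union> m_inv G ` X" "length w \<le> n" "h = word_product G w"
    using assms unfolding word_ball_def by auto
  have "g \<otimes> h = word_product G (v @ w)"
    using word_product_append[of v w] v w subset_trans[OF _ letters_subset[OF assms(1)]] by auto
  thus ?thesis using v w unfolding word_ball_def by (intro image_eqI[of _ _ "v @ w"]) auto
qed

lemma word_ball_inv:
  assumes X: "X \<subseteq> carrier G" and g: "g \<in> word_ball G X n"
  shows "inv g \<in> word_ball G X n"
proof -
  have "inv (word_product G w) \<in> word_ball G X (length w)" if "set w \<subseteq> X \<union> m_inv G ` X" for w
    using that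
  proof (induction w)
    case Nil
    show ?case using one_in_word_ball[of X 0] by simp
  next
    case (Cons x w)
    have x: "x \<in> carrier G" and w: "word_product G w \<in> carrier G"
      using Cons.prems letters_subset[OF X] word_product_closed[of w] by auto
    have "inv x \<in> X \<union> m_inv G ` X" using Cons.prems X by auto
    hence "inv x \<in> word_ball G X 1"
      using x unfolding word_ball_def by (intro image_eqI[of _ _ "[inv x]"]) auto
    moreover have "inv (word_product G w) \<in> word_ball G X (length w)" using Cons by simp
    ultimately show ?case
      using word_ball_mult[OF X, of "inv (word_product G w)" "length w" "inv x" 1] x w
      by (simp add: inv_mult_group)
  qed
  moreover obtain w where "set w \<subseteq> X \<union> m_inv G ` X" "length w \<le> n" "g = word_product G w"
    using g by (auto simp: word_ball_def)
  ultimately show ?thesis using word_ball_mono[of "length w" n X] by auto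
qed

lemma finite_word_ball: "finite X \<Longrightarrow> finite (word_ball G X n)"
  unfolding word_ball_def by (intro finite_imageI finite_lists_length_le) auto

lemma card_ball_pos: "finite X \<Longrightarrow> 1 \<le> card (word_ball G X n)"
  using finite_word_ball one_in_word_ball by (metis One_nat_def Suc_leI card_gt_0_iff empty_iff)

text \<open>A word of length at most \<open>m + n\<close> is cut after its first \<open>m\<close>
  letters.\<close>

lemma card_ball_submult:
  assumes "finite X" "X \<subseteq> carrier G"
  shows "card (word_ball G X (m + n)) \<le> card (word_ball G X m) * card (word_ball G X n)"
proof -
  have "word_ball G X (m + n) \<subseteq> (\<lambda>(g, h). g \<otimes> h) ` (word_ball G X m \<times> word_ball G X n)"
  proof
    fix g assume "g \<in> word_ball G X (m + n)"
    then obtain w where w: "set w \<subseteq> X \<union> m_inv G ` X" "length w \<le> m + n" "g = word_product G w"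
      unfolding word_ball_def by auto
    have sub: "set (take m w) \<subseteq> X \<union> m_inv G ` X" "set (drop m w) \<subseteq> X \<union> m_inv G ` X"
      using w(1) set_take_subset set_drop_subset by (meson subset_trans)+
    have "g = word_product G (take m w) \<otimes> word_product G (drop m w)"
      using word_product_append[of "take m w" "drop m w"] w(3) sub[THEN subset_trans, OF letters_subset[OF assms(2)]]
      by simp
    moreover have "word_product G (take m w) \<in> word_ball G X m" "word_product G (drop m w) \<in> word_ball G X n"
      using sub w(2) unfolding word_ball_def by auto
    ultimately show "g \<in> (\<lambda>(g, h). g \<otimes> h) ` (word_ball G X m \<times> word_ball G X n)" by auto
  qed
  hence "card (word_ball G X (m + n)) \<le> card (word_ball G X m \<times> word_ball G X n)"
    using finite_word_ball[OF assms(1)] by (intro surj_card_le) auto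
  thus ?thesis by (simp add: card_cartesian_product)
qed

lemma generate_imp_word:
  assumes "X \<subseteq> carrier G" "g \<in> generate G X"
  shows "\<exists>w. set w \<subseteq> X \<union> m_inv G ` X \<and> word_product G w = g"
  using assms(2)
proof (induction rule: generate.induct)
  case one
  show ?case by (rule exI[of _ "[]"]) simp
next
  case (incl h)
  then show ?case using assms(1) by (intro exI[of _ "[h]"]) auto
next
  case (inv h)
  then show ?case using assms(1) by (intro exI[of _ "[inv h]"]) auto
next
  case (eng h1 h2)
  then obtain v w where "set v \<subseteq> X \<union> m_inv G ` X" "word_product G v = h1"
      "set w \<subseteq> X \<union> m_inv G ` X" "word_product G w = h2" by auto
  then show ?case
    using word_product_append[of v w] letters_subset[OF assms(1)]
    by (intro exI[of _ "v @ w"]) (auto simp: subset_trans)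
qed

text \<open>Generation supplies a word for every element, so the \<open>LEAST\<close> in
  \<open>word_length\<close> is attained. From here on growth is studied through
  \<open>word_ball\<close>, which avoids \<open>LEAST\<close>.\<close>

lemma growth_function_eq_card_word_ball:
  assumes "finite_generating_set G X"
  shows "growth_function G X n = card (word_ball G X n)"
proof -
  have X: "X \<subseteq> carrier G" and gen: "generate G X = carrier G"
    using assms by (auto simp: finite_generating_set_def)
  have "word_length G X g \<le> n \<longleftrightarrow> g \<in> word_ball G X n" if g: "g \<in> carrier G" for g
  proof
    let ?P = "\<lambda>n. \<exists>w. set w \<subseteq> X \<union> m_inv G ` X \<and> length w = n \<and> word_product G w = g"
    have "\<exists>n. ?P n" using generate_imp_word[OF X] g gen by blast
    hence "?P (word_length G X g)" unfolding word_length_def by (rule LeastI_ex)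
    then show "g \<in> word_ball G X n" if "word_length G X g \<le> n" using that by (auto simp: word_ball_def)
    show "word_length G X g \<le> n" if gn: "g \<in> word_ball G X n"
    proof -
      obtain w where "set w \<subseteq> X \<union> m_inv G ` X" "length w \<le> n" "word_product G w = g"
        using gn unfolding word_ball_def by blast
      moreover from this have "word_length G X g \<le> length w"
        unfolding word_length_def by (intro Least_le) auto
      ultimately show ?thesis by simp
    qed
  qed
  hence "{g \<in> carrier G. word_length G X g \<le> n} = word_ball G X n" using word_ball_subset[OF X] by auto
  thus ?thesis by (simp add: growth_function_def)
qed

section \<open>The growth rate as a limit, and bounds for it\<close>

lemma tendsto_growth_rate:
  assumes "finite_generating_set G X"
  shows "(\<lambda>n. root n (real (card (word_ball G X n)))) \<longlonglongrightarrow> growth_rate G X"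
proof -
  have X: "finite X" "X \<subseteq> carrier G" using assms by (auto simp: finite_generating_set_def)
  have "convergent (\<lambda>n. root n (real (card (word_ball G X n))))"
  proof (rule submultiplicative_root_convergent)
    show "1 \<le> real (card (word_ball G X n))" for n using card_ball_pos[OF X(1)] by simp
    show "real (card (word_ball G X (m + n))) \<le> real (card (word_ball G X m)) * real (card (word_ball G X n))"
      for m n using card_ball_submult[OF X] by (metis of_nat_le_iff of_nat_mult)
  qed
  thus ?thesis
    unfolding growth_rate_def growth_function_eq_card_word_ball[OF assms] by (simp add: convergent_LIMSEQ_iff)
qed

lemma growth_rate_ge_1:
  assumes "finite_generating_set G X"
  shows "1 \<le> growth_rate G X"
proof (rule LIMSEQ_le_const[OF tendsto_growth_rate[OF assms]], intro exI allI impI)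
  fix n :: nat assume "1 \<le> n"
  thus "1 \<le> root n (real (card (word_ball G X n)))"
    using card_ball_pos[of X n] assms by (auto simp: finite_generating_set_def)
qed

text \<open>The limit may be computed along the radii \<open>k * n\<close>, where the root of order
  \<open>k * n\<close> of \<open>2 ^ n\<close> is constantly \<open>root k 2\<close>.\<close>

lemma growth_rate_lower_bound:
  assumes "finite_generating_set G X" "0 < k" "\<And>n. 2 ^ n \<le> card (word_ball G X (k * n))"
  shows "root k 2 \<le> growth_rate G X"
proof -
  have "strict_mono (\<lambda>n. k * n)" using assms(2) by (auto simp: strict_mono_def)
  from LIMSEQ_subseq_LIMSEQ[OF tendsto_growth_rate[OF assms(1)] this]
  have "(\<lambda>n. root (k * n) (real (card (word_ball G X (k * n))))) \<longlonglongrightarrow> growth_rate G X"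
    by (simp add: o_def)
  thus ?thesis
  proof (rule LIMSEQ_le_const, intro exI allI impI)
    fix n :: nat assume n: "1 \<le> n"
    have pow: "(2::real) ^ n \<le> real (card (word_ball G X (k * n)))"
      using assms(3)[of n] by (metis of_nat_le_iff of_nat_numeral of_nat_power)
    have "root k 2 = root k (root n (2 ^ n))" using n by (simp add: real_root_power_cancel)
    also have "\<dots> = root (k * n) (2 ^ n)" by (simp add: real_root_mult_exp)
    also have "\<dots> \<le> root (k * n) (real (card (word_ball G X (k * n))))"
      using assms(2) n pow by (intro real_root_le_mono) auto
    finally show "root k 2 \<le> root (k * n) (real (card (word_ball G X (k * n))))" .
  qed
qed

text \<open>The constant disappears in the limit because \<open>root n C\<close> tends to 1.\<close>

lemma growth_rate_upper_bound:
  fixes r C :: real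
  assumes "finite_generating_set G X" "0 < C" "0 \<le> r" "\<And>n. real (card (word_ball G X n)) \<le> C * r ^ n"
  shows "growth_rate G X \<le> r"
proof (rule LIMSEQ_le[OF tendsto_growth_rate[OF assms(1)]])
  show "(\<lambda>n. root n C * r) \<longlonglongrightarrow> r"
    using tendsto_mult_right[OF LIMSEQ_root_const[OF assms(2)], of r] by simp
  show "\<exists>N. \<forall>n\<ge>N. root n (real (card (word_ball G X n))) \<le> root n C * r"
  proof (intro exI allI impI)
    fix n :: nat assume n: "1 \<le> n"
    have "root n (real (card (word_ball G X n))) \<le> root n (C * r ^ n)" using assms(4) n by simp
    thus "root n (real (card (word_ball G X n))) \<le> root n C * r"
      using n assms(3) by (simp add: real_root_mult real_root_power_cancel)
  qed
qed

end

section \<open>Uniform exponential growth\<close>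

text \<open>A counting form of uniform exponential growth: one \<open>k\<close> serves all
  generating sets and all \<open>n\<close>. It bounds every rate below by \<open>root k 2\<close>,
  and it passes through homomorphisms and subgroups of index two without any limits.\<close>

definition uniformly_exponential :: "('a, 'b) monoid_scheme \<Rightarrow> bool" where
  "uniformly_exponential G \<longleftrightarrow>
     (\<exists>k>0. \<forall>X. finite_generating_set G X \<longrightarrow> (\<forall>n. 2 ^ n \<le> card (word_ball G X (k * n))))"

lemma minimal_growth_rate_le:
  assumes "group G" "finite_generating_set G X"
  shows "minimal_growth_rate G \<le> growth_rate G X"
  unfolding minimal_growth_rate_def
  using assms group.growth_rate_ge_1[OF assms(1)] by (intro cINF_lower bdd_belowI2[of _ 1]) auto

lemma minimal_growth_rate_ge_1:
  assumes "finitely_generated_group G"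
  shows "1 \<le> minimal_growth_rate G"
  unfolding minimal_growth_rate_def
  using assms group.growth_rate_ge_1 by (intro cINF_greatest) (auto simp: finitely_generated_group_def)

lemma minimal_growth_rate_gt_1:
  assumes "finitely_generated_group G" "uniformly_exponential G"
  shows "1 < minimal_growth_rate G"
proof -
  have G: "group G" using assms(1) by (simp add: finitely_generated_group_def)
  obtain k where k: "0 < k"
    "\<And>X n. finite_generating_set G X \<Longrightarrow> 2 ^ n \<le> card (word_ball G X (k * n))"
    using assms(2) unfolding uniformly_exponential_def by auto
  have "root k 2 \<le> minimal_growth_rate G"
    unfolding minimal_growth_rate_def
    using assms(1) group.growth_rate_lower_bound[OF G _ k(1)] k(2)
    by (intro cINF_greatest) (auto simp: finitely_generated_group_def)
  moreover have "1 < root k 2" using k(1) by simp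
  ultimately show ?thesis by linarith
qed

lemma group_hom_restrictI:
  assumes "group G" "subgroup K G" "group Q" "\<phi> \<in> hom (G\<lparr>carrier := K\<rparr>) Q"
  shows "group_hom (G\<lparr>carrier := K\<rparr>) Q \<phi>"
  using assms group.subgroup_imp_group[OF assms(1,2)] by (simp add: group_hom_def group_hom_axioms_def)

text \<open>The predicate \<open>s\<close> is a homomorphism to the group of order two, written as
  exclusive or, and the subgroup is its kernel. A constantly false \<open>s\<close> is allowed and
  gives the whole group.\<close>

lemma (in group) subgroup_index_two:
  assumes s: "\<And>g h. g \<in> carrier G \<Longrightarrow> h \<in> carrier G \<Longrightarrow> s (g \<otimes> h) \<longleftrightarrow> s g \<noteq> s h"
  shows "subgroup {g \<in> carrier G. \<not> s g} G"
proof (rule subgroupI)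
  have one: "\<not> s \<one>" using s[of \<one> \<one>] by simp
  thus "{g \<in> carrier G. \<not> s g} \<noteq> {}" using one_closed by blast
  show "inv g \<in> {g \<in> carrier G. \<not> s g}" if "g \<in> {g \<in> carrier G. \<not> s g}" for g
    using s[of g "inv g"] that one by simp
qed (use s in auto)

text \<open>Schreier's argument for index two: with \<open>t\<close> a letter outside \<open>K\<close>, the elements
  \<open>x\<close>, \<open>t x t\<inverse>\<close> for letters \<open>x \<in> K\<close> and \<open>t x\<close>, \<open>x t\<inverse>\<close> for letters \<open>x \<notin> K\<close> generate \<open>K\<close>.\<close>

lemma (in group) generate_index_two:
  assumes X: "X \<subseteq> carrier G" "generate G X = carrier G"
    and s: "\<And>g h. g \<in> carrier G \<Longrightarrow> h \<in> carrier G \<Longrightarrow> s (g \<otimes> h) \<longleftrightarrow> s g \<noteq> s h"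
  shows "{g \<in> carrier G. \<not> s g} \<subseteq> generate G {g \<in> word_ball G X 3. \<not> s g}"
proof -
  define S where "S = {g \<in> word_ball G X 3. \<not> s g}"
  have s_one: "\<not> s \<one>" using s[of \<one> \<one>] by simp
  have s_inv: "s (inv g) \<longleftrightarrow> s g" if "g \<in> carrier G" for g
    using s[of g "inv g"] that s_one by simp
  have S: "S \<subseteq> carrier G" unfolding S_def using word_ball_subset[OF X(1), of 3] by auto
  have letter: "z \<in> word_ball G X 1" if "z \<in> X \<union> m_inv G ` X" for z
    using incl_word_ball[OF X(1)] word_ball_inv[OF X(1)] that by auto
  have ball_carrier: "z \<in> carrier G" if "z \<in> word_ball G X n" for z n
    using word_ball_subset[OF X(1)] that by blast
  \<comment> \<open>If no letter satisfies \<open>s\<close>, the identity serves as \<open>t\<close>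
    and the condition on \<open>t\<close> is vacuous.\<close>
  obtain t where t: "t \<in> word_ball G X 1" "\<And>z. z \<in> X \<union> m_inv G ` X \<Longrightarrow> s z \<Longrightarrow> s t"
    using letter by (cases "\<exists>z\<in>X \<union> m_inv G ` X. s z") (auto intro: that one_in_word_ball)
  note tc = ball_carrier[OF t(1)]
  have ti: "inv t \<in> word_ball G X 1" using word_ball_inv[OF X(1) t(1)] .
  \<comment> \<open>Both cosets are tracked at once: a word outside the kernel of \<open>s\<close>
    is brought into it by \<open>t\<close> on the left. Prefixing a letter then multiplies by one of
    the four kinds of Schreier generators.\<close>
  have main: "(\<not> s (word_product G w) \<longrightarrow> word_product G w \<in> generate G S) \<and>
      (s (word_product G w) \<longrightarrow> s t \<and> t \<otimes> word_product G w \<in> generate G S)"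
    if "set w \<subseteq> X \<union> m_inv G ` X" for w
    using that
  proof (induction w)
    case Nil
    then show ?case using s_one by (auto intro: generate.one)
  next
    case (Cons x w)
    define h where "h = word_product G w"
    have x: "x \<in> word_ball G X 1" and xX: "x \<in> X \<union> m_inv G ` X" using Cons.prems letter by auto
    note xc = ball_carrier[OF x]
    have hc: "h \<in> carrier G"
      unfolding h_def using Cons.prems letters_subset[OF X(1)] by (intro word_product_closed) auto
    have len2: "t \<otimes> x \<in> word_ball G X 3" "x \<otimes> inv t \<in> word_ball G X 3" "x \<in> word_ball G X 3"
      using word_ball_mult[OF X(1) t(1) x] word_ball_mult[OF X(1) x ti]
        word_ball_mono[of 2 3 X] word_ball_mono[of 1 3 X] x by (auto simp: numeral_2_eq_2)
    have len3: "t \<otimes> x \<otimes> inv t \<in> word_ball G X 3"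
      using word_ball_mult[OF X(1) word_ball_mult[OF X(1) t(1) x] ti] by (simp add: numeral_3_eq_3)
    have IH: "\<not> s h \<Longrightarrow> h \<in> generate G S" "s h \<Longrightarrow> s t" "s h \<Longrightarrow> t \<otimes> h \<in> generate G S"
      using Cons unfolding h_def by auto
    show ?case
    proof (cases "s x"; cases "s h")
      assume c: "s x" "s h"
      have "x \<otimes> inv t \<in> S" using c t(2)[OF xX] len2 xc tc by (simp add: S_def s s_inv)
      hence "(x \<otimes> inv t) \<otimes> (t \<otimes> h) \<in> generate G S"
        using IH c by (blast intro: generate.eng generate.incl)
      moreover have "(x \<otimes> inv t) \<otimes> (t \<otimes> h) = x \<otimes> h"
        using xc tc hc by (simp add: m_assoc inv_solve_left flip: m_assoc[of "inv t" t h])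
      ultimately show ?thesis using c xc hc by (simp add: s flip: h_def)
    next
      assume c: "s x" "\<not> s h"
      have "t \<otimes> x \<in> S" using c t(2)[OF xX] len2 xc tc by (simp add: S_def s)
      hence "(t \<otimes> x) \<otimes> h \<in> generate G S" using IH c by (blast intro: generate.eng generate.incl)
      thus ?thesis using c t(2)[OF xX] xc hc tc by (simp add: s m_assoc flip: h_def)
    next
      assume c: "\<not> s x" "s h"
      have "t \<otimes> x \<otimes> inv t \<in> S" using c len3 xc tc by (simp add: S_def s s_inv)
      hence "(t \<otimes> x \<otimes> inv t) \<otimes> (t \<otimes> h) \<in> generate G S"
        using IH c by (blast intro: generate.eng generate.incl)
      moreover have "(t \<otimes> x \<otimes> inv t) \<otimes> (t \<otimes> h) = t \<otimes> (x \<otimes> h)"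
        using xc tc hc by (simp add: m_assoc flip: m_assoc[of "inv t" t h])
      ultimately show ?thesis using c IH xc hc by (simp add: s flip: h_def)
    next
      assume c: "\<not> s x" "\<not> s h"
      have "x \<in> S" using c len2 by (simp add: S_def)
      hence "x \<otimes> h \<in> generate G S" using IH c by (blast intro: generate.eng generate.incl)
      thus ?thesis using c xc hc by (simp add: s flip: h_def)
    qed
  qed
  show ?thesis
  proof
    fix g assume "g \<in> {g \<in> carrier G. \<not> s g}"
    hence g: "g \<in> generate G X" "\<not> s g" using X(2) by auto
    obtain w where "set w \<subseteq> X \<union> m_inv G ` X" "word_product G w = g"
      using generate_imp_word[OF X(1) g(1)] by blast
    thus "g \<in> generate G {g \<in> word_ball G X 3. \<not> s g}" using main[of w] g(2) by (simp add: S_def)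
  qed
qed

text \<open>The Schreier generators of \<open>K\<close> have length at most 3 over \<open>X\<close>,
  and their images generate \<open>Q\<close>. Words over these images lift to \<open>G\<close> with
  length multiplied by 3, so the constant \<open>k\<close> of \<open>Q\<close> becomes
  \<open>3 * k\<close> for \<open>G\<close>.\<close>

lemma (in group) uniformly_exponential_index_two:
  assumes "group Q"
    and s: "\<And>g h. g \<in> carrier G \<Longrightarrow> h \<in> carrier G \<Longrightarrow> s (g \<otimes> h) \<longleftrightarrow> s g \<noteq> s h"
    and K_def: "K = {g \<in> carrier G. \<not> s g}"
    and \<phi>: "\<phi> \<in> hom (G\<lparr>carrier := K\<rparr>) Q" "\<phi> ` K = carrier Q"
    and Q: "uniformly_exponential Q"
  shows "uniformly_exponential G"
proof -
  have K: "subgroup K G" unfolding K_def using s by (rule subgroup_index_two)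
  interpret Q: group Q by fact
  interpret \<phi>: group_hom "G\<lparr>carrier := K\<rparr>" Q \<phi>
    using group_hom_restrictI[OF is_group K assms(1) \<phi>(1)] .
  obtain k where k: "0 < k"
    "\<And>Y n. finite_generating_set Q Y \<Longrightarrow> 2 ^ n \<le> card (word_ball Q Y (k * n))"
    using Q unfolding uniformly_exponential_def by auto
  have "2 ^ n \<le> card (word_ball G X (3 * k * n))" if gen: "finite_generating_set G X" for X n
  proof -
    have X: "finite X" "X \<subseteq> carrier G" "generate G X = carrier G"
      using gen by (auto simp: finite_generating_set_def)
    define S where "S = {g \<in> word_ball G X 3. \<not> s g}"
    have SK: "S \<subseteq> K" unfolding S_def K_def using word_ball_subset[OF X(2)] by auto
    have fS: "finite S" unfolding S_def using finite_word_ball[OF X(1)] by simp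
    have "K \<subseteq> generate G S" unfolding S_def K_def by (rule generate_index_two[OF X(2,3) s])
    moreover have "generate G S \<subseteq> K" using generate_subgroup_incl[OF SK K] .
    ultimately have "generate (G\<lparr>carrier := K\<rparr>) S = K"
      using generate_consistent[OF SK K] by simp
    hence genY: "finite_generating_set Q (\<phi> ` S)"
      using \<phi>.generate_img[of S] SK fS \<phi>(2) \<phi>.hom_closed unfolding finite_generating_set_def by auto
    have word: "word_product Q v \<in> \<phi> ` (K \<inter> word_ball G X (3 * length v))"
      if "set v \<subseteq> \<phi> ` S \<union> m_inv Q ` \<phi> ` S" for v
      using that
    proof (induction v)
      case Nil
      have "\<one>\<^bsub>Q\<^esub> = \<phi> \<one>" using \<phi>.hom_one by simp
      thus ?case using one_in_word_ball[of X 0] subgroup.one_closed[OF K] by auto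
    next
      case (Cons y v)
      obtain g where g: "g \<in> K" "g \<in> word_ball G X 3" "y = \<phi> g"
      proof -
        consider a where "a \<in> S" "y = \<phi> a" | a where "a \<in> S" "y = inv\<^bsub>Q\<^esub> \<phi> a" using Cons.prems by auto
        thus thesis
        proof cases
          case 1
          thus ?thesis using that SK by (auto simp: S_def)
        next
          case (2 a)
          have aK: "a \<in> K" using 2 SK by auto
          have "y = \<phi> (inv a)"
            using \<phi>.hom_inv[of a] 2 aK m_inv_consistent[OF K aK] by simp
          moreover have "inv a \<in> K" using subgroup.m_inv_closed[OF K aK] .
          moreover have "inv a \<in> word_ball G X 3" using word_ball_inv[OF X(2)] 2 by (simp add: S_def)
          ultimately show ?thesis using that by blast
        qed
      qed
      obtain h where h: "h \<in> K" "h \<in> word_ball G X (3 * length v)" "word_product Q v = \<phi> h"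
        using Cons by auto
      have "g \<otimes> h \<in> word_ball G X (3 * length (y # v))"
        using word_ball_mult[OF X(2) g(2) h(2)] by simp
      moreover have "g \<otimes> h \<in> K" using subgroup.m_closed[OF K g(1) h(1)] .
      moreover have "word_product Q (y # v) = \<phi> (g \<otimes> h)"
        using \<phi>.hom_mult[of g h] g h by simp
      ultimately show ?case by blast
    qed
    have "word_ball Q (\<phi> ` S) (k * n) \<subseteq> \<phi> ` word_ball G X (3 * (k * n))"
    proof
      fix y assume "y \<in> word_ball Q (\<phi> ` S) (k * n)"
      then obtain v where v: "set v \<subseteq> \<phi> ` S \<union> m_inv Q ` \<phi> ` S" "length v \<le> k * n" "y = word_product Q v"
        by (auto simp: word_ball_def)
      show "y \<in> \<phi> ` word_ball G X (3 * (k * n))"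
        using word[OF v(1)] v(2,3) word_ball_mono[of "3 * length v" "3 * (k * n)" X] by auto
    qed
    hence "card (word_ball Q (\<phi> ` S) (k * n)) \<le> card (word_ball G X (3 * (k * n)))"
      using finite_word_ball[OF X(1)] by (rule surj_card_le[rotated])
    thus ?thesis using k(2)[OF genY, of n] by (simp add: mult.assoc)
  qed
  thus ?thesis unfolding uniformly_exponential_def using k(1) by (intro exI[of _ "3 * k"]) auto
qed

text \<open>The degenerate case in which \<open>s\<close> is constantly false and \<open>K\<close>
  is the whole group.\<close>

lemma uniformly_exponential_hom_image:
  assumes "group G" "group Q" "\<phi> \<in> hom G Q" "\<phi> ` carrier G = carrier Q" "uniformly_exponential Q"
  shows "uniformly_exponential G"
  using assms group.uniformly_exponential_index_two[OF assms(1,2), of "\<lambda>_. False" "carrier G" \<phi>] by simp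

section \<open>Elementary amenable groups up to isomorphism\<close>

lemma image_group_iso:
  assumes "group G" "inj_on f (carrier G)"
  shows "f \<in> iso G (image_group f G)" and "group (image_group f G)"
proof -
  interpret group G by fact
  show iso: "f \<in> iso G (image_group f G)"
    using assms(2) by (auto simp: iso_def hom_def bij_betw_def image_group_def)
  show "group (image_group f G)"
    using iso_imp_img_group[OF iso] by (simp add: image_group_def)
qed

lemma elementary_amenable_group: "elementary_amenable G \<Longrightarrow> group G"
  by (induction rule: elementary_amenable.induct)
    (auto simp: comm_group_def intro: group.subgroup_imp_group)

text \<open>An isomorphism is surjective, so \<open>H\<close> is the quotient of \<open>G\<close> by
  its kernel and the rule \<open>quotient\<close> applies.\<close>

lemma elementary_amenable_iso:
  fixes G H :: "'a monoid"
  assumes "elementary_amenable G" "G \<cong> H" "group H"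
  shows "elementary_amenable H"
proof -
  have G: "group G" using elementary_amenable_group[OF assms(1)] .
  obtain h where h: "h \<in> iso G H" using assms(2) by (auto simp: is_iso_def)
  interpret group_hom G H h
    using G assms(3) h by (simp add: group_hom_def group_hom_axioms_def iso_def)
  have "G Mod kernel G H h \<cong> H"
    using h by (intro FactGroup_iso) (simp add: Group.iso_iff)
  thus ?thesis using elementary_amenable.quotient[OF assms(1) normal_kernel assms(3)] by simp
qed

text \<open>The class lives on one fixed type, whereas the construction passes through triples and
  lamp configurations. This predicate lets groups on such types take part in the closure
  arguments.\<close>

definition elementary_amenable_copy :: "'a itself \<Rightarrow> ('g, 'b) monoid_scheme \<Rightarrow> bool" where
  "elementary_amenable_copy _ G \<longleftrightarrow> (\<exists>H :: 'a monoid. elementary_amenable H \<and> G \<cong> H)"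

lemma elementary_amenable_copy_comm:
  fixes f :: "'g \<Rightarrow> 'a"
  assumes "comm_group G" "inj_on f (carrier G)"
  shows "elementary_amenable_copy TYPE('a) G"
proof -
  have G: "group G" using assms(1) by (simp add: comm_group_def)
  have "comm_group (image_group f G)"
  proof (rule group.group_comm_groupI[OF image_group_iso(2)[OF G assms(2)]])
    fix x y assume "x \<in> carrier (image_group f G)" "y \<in> carrier (image_group f G)"
    thus "x \<otimes>\<^bsub>image_group f G\<^esub> y = y \<otimes>\<^bsub>image_group f G\<^esub> x"
      using comm_groupE(4)[OF assms(1)] by (auto simp: image_group_def inv_into_into)
  qed
  thus ?thesis
    unfolding elementary_amenable_copy_def
    using elementary_amenable.abelian is_isoI[OF image_group_iso(1)[OF G assms(2)]] by blast
qed

lemma elementary_amenable_copy_iso: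
  assumes "elementary_amenable_copy TYPE('a) H" "G \<cong> H"
  shows "elementary_amenable_copy TYPE('a) G"
  using assms iso_trans unfolding elementary_amenable_copy_def by blast

lemma elementary_amenable_of_copy:
  assumes "elementary_amenable_copy TYPE('a) G" "group G" "group H" "G \<cong> H"
  shows "elementary_amenable (H :: 'a monoid)"
proof -
  obtain L :: "'a monoid" where L: "elementary_amenable L" "G \<cong> L"
    using assms(1) by (auto simp: elementary_amenable_copy_def)
  have "L \<cong> H" using group.iso_sym[OF assms(2) L(2)] assms(4) by (rule iso_trans)
  thus ?thesis using elementary_amenable_iso L(1) assms(3) by blast
qed

lemma iso_restrict:
  assumes "h \<in> iso G H" "K \<subseteq> carrier G"
  shows "h \<in> iso (G\<lparr>carrier := K\<rparr>) (H\<lparr>carrier := h ` K\<rparr>)"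
  using assms by (auto simp: iso_def hom_def bij_betw_def subset_iff intro: inj_on_subset)

lemma elementary_amenable_copy_subgroup:
  assumes "elementary_amenable_copy TYPE('a) G" "group G" "subgroup K G"
  shows "elementary_amenable_copy TYPE('a) (G\<lparr>carrier := K\<rparr>)"
proof -
  obtain H :: "'a monoid" and h where H: "elementary_amenable H" "h \<in> iso G H"
    using assms(1) by (auto simp: elementary_amenable_copy_def is_iso_def)
  interpret group_hom G H h
    using assms(2) H elementary_amenable_group[OF H(1)]
    by (simp add: group_hom_def group_hom_axioms_def iso_def)
  have "elementary_amenable (H\<lparr>carrier := h ` K\<rparr>)"
    using elementary_amenable.subgroup[OF H(1) subgroup_img_is_subgroup[OF assms(3)]] .
  moreover have "G\<lparr>carrier := K\<rparr> \<cong> H\<lparr>carrier := h ` K\<rparr>"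
    using is_isoI iso_restrict[OF H(2)] subgroup.subset[OF assms(3)] by blast
  ultimately show ?thesis by (auto simp: elementary_amenable_copy_def)
qed

text \<open>The rule \<open>extension\<close> wants the group, the normal subgroup and the quotient
  on one type. So \<open>G\<close> is moved along \<open>f\<close> to \<open>H\<close>, and
  \<open>\<phi>\<close> becomes a map \<open>\<psi>\<close> from \<open>H\<close> onto a copy
  \<open>R\<close> of \<open>Q\<close>, whose kernel is the \<open>f\<close>-image of the kernel of
  \<open>\<phi>\<close>.\<close>

lemma elementary_amenable_copy_extension:
  fixes f :: "'g \<Rightarrow> 'a"
  assumes G: "group G" "inj_on f (carrier G)" and Q: "group Q"
    and \<phi>: "\<phi> \<in> hom G Q" "\<phi> ` carrier G = carrier Q"
    and "elementary_amenable_copy TYPE('a) Q"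
    and N: "elementary_amenable_copy TYPE('a) (G\<lparr>carrier := kernel G Q \<phi>\<rparr>)"
  shows "elementary_amenable_copy TYPE('a) G"
proof -
  obtain R :: "'a monoid" and h where R: "elementary_amenable R" "h \<in> iso Q R"
    using assms(6) by (auto simp: elementary_amenable_copy_def is_iso_def)
  have grpR: "group R" using elementary_amenable_group[OF R(1)] .
  define H where "H = image_group f G"
  have fH: "f \<in> iso G H" and H: "group H" using image_group_iso[OF G] by (auto simp: H_def)
  define g where "g = inv_into (carrier G) f"
  have g: "g \<in> iso H G" using group.iso_set_sym[OF G(1) fH] by (simp add: g_def)
  have gf: "g (f x) = x" if "x \<in> carrier G" for x using G(2) that by (simp add: g_def)
  define \<psi> where "\<psi> = h \<circ> (\<phi> \<circ> g)"
  have hom\<psi>: "\<psi> \<in> hom H R"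
    using R(2) g \<phi>(1) unfolding \<psi>_def by (auto intro!: Group.hom_compose simp: iso_def)
  have surj\<psi>: "\<psi> ` carrier H = carrier R"
  proof -
    have "\<psi> ` carrier H = h ` \<phi> ` g ` carrier H" by (simp add: \<psi>_def image_comp comp_assoc)
    also have "\<dots> = carrier R" using R(2) g \<phi>(2) by (simp only: iso_iff)
    finally show ?thesis .
  qed
  interpret \<psi>: group_hom H R \<psi>
    using H grpR hom\<psi> by (simp add: group_hom_def group_hom_axioms_def)
  interpret \<phi>: group_hom G Q \<phi>
    using G(1) Q \<phi>(1) by (simp add: group_hom_def group_hom_axioms_def)
  have h1: "h y = \<one>\<^bsub>R\<^esub> \<longleftrightarrow> y = \<one>\<^bsub>Q\<^esub>" if "y \<in> carrier Q" for y
  proof -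
    have "h \<one>\<^bsub>Q\<^esub> = \<one>\<^bsub>R\<^esub>" using hom_one[OF _ Q grpR] R(2) by (simp add: iso_def)
    moreover have "inj_on h (carrier Q)" using R(2) by (simp add: iso_iff)
    ultimately show ?thesis using that by (metis inj_onD monoid.one_closed Q group.is_monoid)
  qed
  have ker: "kernel H R \<psi> = f ` kernel G Q \<phi>"
  proof -
    have "carrier H = f ` carrier G" by (simp add: H_def image_group_def)
    thus ?thesis unfolding kernel_def using gf h1 \<phi>.hom_closed by (auto simp: \<psi>_def)
  qed
  have "G\<lparr>carrier := kernel G Q \<phi>\<rparr> \<cong> H\<lparr>carrier := kernel H R \<psi>\<rparr>"
      unfolding ker by (rule is_isoI[OF iso_restrict[OF fH subgroup.subset[OF \<phi>.subgroup_kernel]]])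
  hence "elementary_amenable (H\<lparr>carrier := kernel H R \<psi>\<rparr>)"
    using group.subgroup_imp_group[OF G(1) \<phi>.subgroup_kernel]
      group.subgroup_imp_group[OF H \<psi>.subgroup_kernel]
    by (intro elementary_amenable_of_copy[OF N])
  hence "elementary_amenable H"
    using elementary_amenable.extension[OF H \<psi>.normal_kernel _ R(1)] \<psi>.FactGroup_iso[OF surj\<psi>] by simp
  thus ?thesis using is_isoI[OF fH] by (auto simp: elementary_amenable_copy_def)
qed

section \<open>Contraction in the wreath product\<close>

text \<open>Generators are named by abstract letters because weights belong to letters, and
  different letters may denote the same group element.\<close>

datatype letter = La | Lb | Lc | Ld

lemma UNIV_letter: "UNIV = {La, Lb, Lc, Ld}"
  using letter.exhaust by auto

text \<open>The weights satisfy the triangle inequality on \<open>Lb\<close>, \<open>Lc\<close>, \<open>Ld\<close>, and each of the passages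
  \<open>ab \<mapsto> a, c\<close>, \<open>ac \<mapsto> a, d\<close>, \<open>ad \<mapsto> b\<close> to the coordinates of the wreath product lowers
  the total weight by a factor of at most \<open>6/7\<close>.\<close>

fun weight :: "letter \<Rightarrow> nat" where
  "weight La = 3" | "weight Lb = 4" | "weight Lc = 3" | "weight Ld = 2"

text \<open>The identity and the images of \<open>Lb\<close>, \<open>Lc\<close>, \<open>Ld\<close>
  form a quotient of the Klein four-group. Generation is demanded separately in
  \<open>admissible\<close>, since the letters of \<open>wreath_marking\<close> need not generate
  the full wreath product.\<close>

definition marking :: "('g, 'b) monoid_scheme \<Rightarrow> (letter \<Rightarrow> 'g) \<Rightarrow> bool" where
  "marking G e \<longleftrightarrow> group G \<and> range e \<subseteq> carrier G \<and>
     e La \<otimes>\<^bsub>G\<^esub> e La = \<one>\<^bsub>G\<^esub> \<and> e Lb \<otimes>\<^bsub>G\<^esub> e Lb = \<one>\<^bsub>G\<^esub> \<and> e Lc \<otimes>\<^bsub>G\<^esub> e Lc = \<one>\<^bsub>G\<^esub> \<and>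
     e Lb \<otimes>\<^bsub>G\<^esub> e Lc = e Ld \<and> e Lc \<otimes>\<^bsub>G\<^esub> e Lb = e Ld"

text \<open>Words have no inverse letters: under a marking every letter is an involution.\<close>

definition weighted_ball :: "('g, 'b) monoid_scheme \<Rightarrow> (letter \<Rightarrow> 'g) \<Rightarrow> nat \<Rightarrow> 'g set" where
  "weighted_ball G e n = {word_product G (map e w) | w. sum_list (map weight w) \<le> n}"

definition growth_bounded :: "('g, 'b) monoid_scheme \<Rightarrow> (letter \<Rightarrow> 'g) \<Rightarrow> real \<Rightarrow> bool" where
  "growth_bounded G e r \<longleftrightarrow> (\<exists>K>0. \<forall>n. real (card (weighted_ball G e n)) \<le> K * r ^ n)"

lemma marking_group: "marking G e \<Longrightarrow> group G"
  by (simp add: marking_def)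

lemma marking_closed: "marking G e \<Longrightarrow> e x \<in> carrier G"
  by (auto simp: marking_def)

lemma marking_product:
  fixes G (structure)
  assumes "marking G e" "x \<noteq> La" "y \<noteq> La"
  shows "e x \<otimes>\<^bsub>G\<^esub> e y = \<one>\<^bsub>G\<^esub> \<or>
    (\<exists>z. z \<noteq> La \<and> e x \<otimes>\<^bsub>G\<^esub> e y = e z \<and> weight z \<le> weight x + weight y)"
proof -
  interpret group G using assms(1) by (rule marking_group)
  have rel: "e Lb \<otimes>\<^bsub>G\<^esub> e Lb = \<one>\<^bsub>G\<^esub>" "e Lc \<otimes>\<^bsub>G\<^esub> e Lc = \<one>\<^bsub>G\<^esub>"
    "e Lb \<otimes>\<^bsub>G\<^esub> e Lc = e Ld" "e Lc \<otimes>\<^bsub>G\<^esub> e Lb = e Ld"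
    using assms(1) by (auto simp: marking_def)
  have c: "e z \<in> carrier G" for z using marking_closed[OF assms(1)] .
  have 1: "e Lb \<otimes> e Ld = e Lc" using rel c by (metis l_one m_assoc)
  have 2: "e Lc \<otimes> e Ld = e Lb" using rel c by (metis l_one m_assoc)
  have 3: "e Ld \<otimes> e Lc = e Lb" using rel c by (metis r_one m_assoc)
  have 4: "e Ld \<otimes> e Lb = e Lc" using rel c by (metis r_one m_assoc)
  have 5: "e Ld \<otimes> e Ld = \<one>" using rel 2 c by (metis m_assoc)
  have "x \<in> {Lb, Lc, Ld}" "y \<in> {Lb, Lc, Ld}" using assms(2,3) UNIV_letter by auto
  thus ?thesis using rel 1 2 3 4 5 by (auto intro: exI[of _ Lb] exI[of _ Lc] exI[of _ Ld])
qed

lemma marking_involution: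
  fixes G (structure)
  assumes "marking G e"
  shows "e x \<otimes>\<^bsub>G\<^esub> e x = \<one>\<^bsub>G\<^esub>"
proof -
  interpret group G using assms by (rule marking_group)
  have rel: "e Lb \<otimes> e Lb = \<one>" "e Lc \<otimes> e Lc = \<one>" "e Lb \<otimes> e Lc = e Ld" "e Lc \<otimes> e Lb = e Ld"
    using assms by (auto simp: marking_def)
  have c: "e z \<in> carrier G" for z using marking_closed[OF assms] .
  have "e Ld \<otimes> e Ld = e Lb \<otimes> (e Lc \<otimes> e Lc) \<otimes> e Lb" using rel c by (metis m_assoc m_closed)
  hence "e Ld \<otimes> e Ld = \<one>" using rel c by simp
  thus ?thesis using assms by (cases x) (auto simp: marking_def)
qed

lemma length_le_weight: "length w \<le> sum_list (map weight w)"
proof (induction w)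
  case (Cons x w)
  then show ?case by (cases x) auto
qed simp

lemma weight_le_length: "sum_list (map weight w) \<le> 4 * length w"
proof (induction w)
  case (Cons x w)
  then show ?case by (cases x) auto
qed simp

lemma weighted_ball_subset_lists:
  "weighted_ball G e n \<subseteq> (\<lambda>w. word_product G (map e w)) ` {w. set w \<subseteq> {La, Lb, Lc, Ld} \<and> length w \<le> n}"
  using length_le_weight le_trans UNIV_letter unfolding weighted_ball_def by fastforce

lemma finite_weighted_ball: "finite (weighted_ball G e n)"
  by (rule finite_subset[OF weighted_ball_subset_lists]) (simp add: finite_lists_length_le)

text \<open>Every letter weighs at least 1, so it is enough to count words of at most
  \<open>n\<close> letters over an alphabet of four. This crude rate starts the iteration.\<close>

lemma growth_bounded_5: "growth_bounded G e 5"
proof -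
  have "card (weighted_ball G e n) \<le> 5 ^ Suc n" for n
  proof -
    have "card (weighted_ball G e n) \<le> card {w. set w \<subseteq> {La, Lb, Lc, Ld} \<and> length w \<le> n}"
      using weighted_ball_subset_lists by (rule surj_card_le[rotated]) (simp add: finite_lists_length_le)
    also have "\<dots> = (\<Sum>i\<le>n. card {La, Lb, Lc, Ld} ^ i)" by (rule card_lists_length_le) simp
    also have "card {La, Lb, Lc, Ld} = 4" by simp
    also have "(\<Sum>i\<le>n. 4 ^ i) \<le> (5::nat) ^ Suc n"
    proof (induction n)
      case (Suc n)
      have "(4::nat) ^ Suc n \<le> 5 ^ Suc n" by (rule power_mono) auto
      with Suc show ?case by simp
    qed simp
    finally show ?thesis .
  qed
  hence "real (card (weighted_ball G e n)) \<le> 5 * 5 ^ n" for n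
    by (metis of_nat_le_iff of_nat_numeral of_nat_power power_Suc)
  thus ?thesis unfolding growth_bounded_def by (intro exI[of _ 5]) auto
qed

lemma weighted_ball_Cons:
  "g \<in> weighted_ball G e n \<Longrightarrow> e x \<otimes>\<^bsub>G\<^esub> g \<in> weighted_ball G e (n + weight x)"
  unfolding weighted_ball_def by (force intro: exI[of _ "x # w" for w])

lemma one_in_weighted_ball: "\<one>\<^bsub>G\<^esub> \<in> weighted_ball G e n"
  unfolding weighted_ball_def by (auto intro!: exI[of _ "[]"])

lemma weighted_ball_mono: "m \<le> n \<Longrightarrow> weighted_ball G e m \<subseteq> weighted_ball G e n"
  unfolding weighted_ball_def by auto

lemma word_ball_subset_weighted_ball:
  fixes G (structure)
  assumes "marking G e"
  shows "word_ball G (range e) n \<subseteq> weighted_ball G e (4 * n)"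
proof
  interpret group G using assms by (rule marking_group)
  fix g assume "g \<in> word_ball G (range e) n"
  then obtain w where w: "set w \<subseteq> range e \<union> m_inv G ` range e" "length w \<le> n" "g = word_product G w"
    by (auto simp: word_ball_def)
  have "inv (e x) = e x" for x
    using marking_involution[OF assms] marking_closed[OF assms] by (simp add: inv_equality)
  hence "range e \<union> m_inv G ` range e = range e" by (auto simp: image_image)
  hence "\<forall>y\<in>set w. \<exists>x. y = e x" using w(1) by auto
  then obtain v where v: "w = map e v" by (metis ex_map_conv)
  have "sum_list (map weight v) \<le> 4 * n" using weight_le_length[of v] w(2) v by simp
  thus "g \<in> weighted_ball G e (4 * n)" using w(3) v unfolding weighted_ball_def by blast
qed

text \<open>Values of words in which \<open>La\<close> alternates with the other letters. The flag
  tells whether the word begins with \<open>La\<close>, the number is its weight, and the empty word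
  carries either flag.\<close>

inductive alternating :: "('g, 'b) monoid_scheme \<Rightarrow> (letter \<Rightarrow> 'g) \<Rightarrow> bool \<Rightarrow> 'g \<Rightarrow> nat \<Rightarrow> bool"
  for G e where
  one: "alternating G e b \<one>\<^bsub>G\<^esub> 0"
| cons_La: "alternating G e False g n \<Longrightarrow> alternating G e True (e La \<otimes>\<^bsub>G\<^esub> g) (n + 3)"
| cons_V: "x \<noteq> La \<Longrightarrow> alternating G e True g n \<Longrightarrow> alternating G e False (e x \<otimes>\<^bsub>G\<^esub> g) (n + weight x)"

lemma alternating_closed:
  fixes G (structure)
  assumes "alternating G e b g n" "marking G e"
  shows "g \<in> carrier G"
proof -
  interpret group G using assms(2) by (rule marking_group)
  show ?thesis using assms(1) by induction (auto simp: marking_closed[OF assms(2)])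
qed

text \<open>A new \<open>La\<close> cancels against a leading \<open>La\<close>, and a new letter
  among \<open>Lb\<close>, \<open>Lc\<close>, \<open>Ld\<close> merges with a leading one by
  \<open>marking_product\<close>; otherwise the word just becomes longer. The weight never exceeds
  the sum.\<close>

lemma alternating_Cons:
  fixes G (structure)
  assumes e: "marking G e" and g: "alternating G e b g n"
  shows "\<exists>b m. m \<le> n + weight x \<and> alternating G e b (e x \<otimes>\<^bsub>G\<^esub> g) m"
proof -
  interpret group G using e by (simp add: marking_def)
  note c = marking_closed[OF e]
  show ?thesis
    using g
  proof (cases rule: alternating.cases)
    case one
    show ?thesis
    proof (cases "x = La")
      case True
      then show ?thesis using alternating.cons_La[OF alternating.one, of G e] one
        by (intro exI[of _ True] exI[of _ 3]) simp
    next
      case False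
      then show ?thesis using alternating.cons_V[OF False alternating.one, of G e] one
        by (intro exI[of _ False] exI[of _ "weight x"]) simp
    qed
  next
    case (cons_La h k)
    have h: "h \<in> carrier G" using alternating_closed[OF cons_La(4) e] .
    show ?thesis
    proof (cases "x = La")
      case True
      hence "e x \<otimes> g = h" using cons_La(2) marking_involution[OF e] c h by (simp flip: m_assoc)
      then show ?thesis using cons_La by (intro exI[of _ False] exI[of _ k]) simp
    next
      case False
      then show ?thesis using alternating.cons_V[OF False] g cons_La(1)
        by (intro exI[of _ False] exI[of _ "n + weight x"]) simp
    qed
  next
    case (cons_V y h k)
    have h: "h \<in> carrier G" using alternating_closed[OF cons_V(5) e] .
    have eq: "e x \<otimes> g = (e x \<otimes> e y) \<otimes> h" using cons_V c h by (simp add: m_assoc)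
    show ?thesis
    proof (cases "x = La")
      case True
      then show ?thesis using alternating.cons_La g cons_V(1)
        by (intro exI[of _ True] exI[of _ "n + 3"]) simp
    next
      case False
      from marking_product[OF e False cons_V(4)] show ?thesis
      proof
        assume "e x \<otimes> e y = \<one>"
        then show ?thesis using eq h cons_V by (intro exI[of _ True] exI[of _ k]) simp
      next
        assume "\<exists>z. z \<noteq> La \<and> e x \<otimes> e y = e z \<and> weight z \<le> weight x + weight y"
        then obtain z where z: "z \<noteq> La" "e x \<otimes> e y = e z" "weight z \<le> weight x + weight y" by auto
        show ?thesis using alternating.cons_V[OF z(1) cons_V(5)] z eq cons_V(3)
          by (intro exI[of _ False] exI[of _ "k + weight z"]) simp
      qed
    qed
  qed
qed

lemma weighted_ball_alternating:
  assumes "marking G e" "g \<in> weighted_ball G e n"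
  shows "\<exists>b m. m \<le> n \<and> alternating G e b g m"
proof -
  have "\<exists>b m. m \<le> sum_list (map weight w) \<and> alternating G e b (word_product G (map e w)) m" for w
  proof (induction w)
    case Nil
    then show ?case by (auto intro: alternating.one)
  next
    case (Cons x w)
    then obtain b m where "m \<le> sum_list (map weight w)" "alternating G e b (word_product G (map e w)) m"
      by auto
    moreover obtain b' m' where "m' \<le> m + weight x"
      "alternating G e b' (e x \<otimes>\<^bsub>G\<^esub> word_product G (map e w)) m'"
      using alternating_Cons[OF assms(1) calculation(2), of x] by auto
    ultimately show ?case by (intro exI[of _ b'] exI[of _ m']) simp
  qed
  moreover obtain w where "g = word_product G (map e w)" "sum_list (map weight w) \<le> n"
    using assms(2) by (auto simp: weighted_ball_def)
  ultimately show ?thesis using order_trans by blast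
qed

section \<open>The wreath product by the group of order two\<close>

definition wreath2 :: "('g, 'b) monoid_scheme \<Rightarrow> ('g \<times> 'g \<times> bool) monoid" where
  "wreath2 G = \<lparr>carrier = carrier G \<times> carrier G \<times> UNIV,
     monoid.mult = (\<lambda>(x, y, s) (x', y', s').
       if s then (x \<otimes>\<^bsub>G\<^esub> y', y \<otimes>\<^bsub>G\<^esub> x', \<not> s') else (x \<otimes>\<^bsub>G\<^esub> x', y \<otimes>\<^bsub>G\<^esub> y', s')),
     one = (\<one>\<^bsub>G\<^esub>, \<one>\<^bsub>G\<^esub>, False)\<rparr>"

fun wreath_marking :: "('g, 'b) monoid_scheme \<Rightarrow> (letter \<Rightarrow> 'g) \<Rightarrow> letter \<Rightarrow> 'g \<times> 'g \<times> bool" where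
  "wreath_marking G e La = (\<one>\<^bsub>G\<^esub>, \<one>\<^bsub>G\<^esub>, True)"
| "wreath_marking G e Lb = (e La, e Lc, False)"
| "wreath_marking G e Lc = (e La, e Ld, False)"
| "wreath_marking G e Ld = (\<one>\<^bsub>G\<^esub>, e Lb, False)"

lemma wreath2_simps [simp]:
  "carrier (wreath2 G) = carrier G \<times> carrier G \<times> UNIV"
  "\<one>\<^bsub>wreath2 G\<^esub> = (\<one>\<^bsub>G\<^esub>, \<one>\<^bsub>G\<^esub>, False)"
  "(x, y, True) \<otimes>\<^bsub>wreath2 G\<^esub> (x', y', s') = (x \<otimes>\<^bsub>G\<^esub> y', y \<otimes>\<^bsub>G\<^esub> x', \<not> s')"
  "(x, y, False) \<otimes>\<^bsub>wreath2 G\<^esub> (x', y', s') = (x \<otimes>\<^bsub>G\<^esub> x', y \<otimes>\<^bsub>G\<^esub> y', s')"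
  by (simp_all add: wreath2_def)

lemma group_wreath2:
  fixes G (structure)
  assumes "group G"
  shows "group (wreath2 G)"
proof -
  interpret group G by fact
  show ?thesis
  proof (rule groupI)
    fix u v w assume "u \<in> carrier (wreath2 G)" "v \<in> carrier (wreath2 G)" "w \<in> carrier (wreath2 G)"
    then obtain x y s x' y' s' x'' y'' s'' where "u = (x, y, s)" "v = (x', y', s')" "w = (x'', y'', s'')"
      "x \<in> carrier G" "y \<in> carrier G" "x' \<in> carrier G" "y' \<in> carrier G" "x'' \<in> carrier G" "y'' \<in> carrier G"
      by auto
    thus "u \<otimes>\<^bsub>wreath2 G\<^esub> v \<otimes>\<^bsub>wreath2 G\<^esub> w = u \<otimes>\<^bsub>wreath2 G\<^esub> (v \<otimes>\<^bsub>wreath2 G\<^esub> w)"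
      by (cases s; cases s') (simp_all add: m_assoc)
  next
    fix u v assume "u \<in> carrier (wreath2 G)" "v \<in> carrier (wreath2 G)"
    then show "u \<otimes>\<^bsub>wreath2 G\<^esub> v \<in> carrier (wreath2 G)"
      by (cases u; cases v) (auto simp: wreath2_def)
  next
    fix u assume u: "u \<in> carrier (wreath2 G)"
    then obtain x y s where "u = (x, y, s)" "x \<in> carrier G" "y \<in> carrier G" by auto
    then show "\<exists>v\<in>carrier (wreath2 G). v \<otimes>\<^bsub>wreath2 G\<^esub> u = \<one>\<^bsub>wreath2 G\<^esub>"
      by (cases s; intro bexI[of _ "if s then (inv y, inv x, True) else (inv x, inv y, False)"]) auto
  next
    fix u assume u: "u \<in> carrier (wreath2 G)"
    then show "\<one>\<^bsub>wreath2 G\<^esub> \<otimes>\<^bsub>wreath2 G\<^esub> u = u" by auto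
  qed auto
qed

text \<open>The relations are checked coordinatewise. For instance
  \<open>bc = (aa, cd) = (1, b) = d\<close>, which uses that \<open>cd = b\<close> already holds in
  \<open>G\<close>.\<close>

lemma marking_wreath2:
  fixes G (structure)
  assumes "marking G e"
  shows "marking (wreath2 G) (wreath_marking G e)"
proof -
  interpret group G using assms by (rule marking_group)
  have c: "e x \<in> carrier G" for x using marking_closed[OF assms] .
  have inv: "e x \<otimes> e x = \<one>" for x using marking_involution[OF assms] .
  have "e Lb \<otimes> e Lc = e Ld" "e Lc \<otimes> e Lb = e Ld" using assms by (auto simp: marking_def)
  hence "e Lc \<otimes> e Ld = e Lb" "e Ld \<otimes> e Lc = e Lb"
    using inv[of Lc] c by (metis l_one r_one m_assoc)+
  moreover have "wreath_marking G e x \<in> carrier (wreath2 G)" for x using c by (cases x) auto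
  hence "range (wreath_marking G e) \<subseteq> carrier (wreath2 G)" by blast
  ultimately show ?thesis using group_wreath2[OF is_group] inv by (simp add: marking_def)
qed

text \<open>The slack \<open>18 = 6 \<cdot> weight La\<close> pays for a leading letter from \<open>Lb\<close>, \<open>Lc\<close>, \<open>Ld\<close> and is
  restored by the letter \<open>La\<close> that precedes it.\<close>

lemma alternating_wreath2_contracting:
  assumes "alternating (wreath2 G) (wreath_marking G e) b g m" "marking G e"
  shows "\<exists>x y s i j. g = (x, y, s) \<and> x \<in> weighted_ball G e i \<and> y \<in> weighted_ball G e j \<and>
    7 * (i + j) + (if b then 18 else 0) \<le> 6 * m + 18"
  using assms
proof (induction rule: alternating.induct)
  case (one b)
  show ?case by (auto intro!: exI[of _ 0] one_in_weighted_ball)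
next
  case (cons_La g n)
  then obtain x y s i j where h: "g = (x, y, s)" "x \<in> weighted_ball G e i" "y \<in> weighted_ball G e j"
    "7 * (i + j) \<le> 6 * n + 18" by auto
  have "g \<in> carrier (wreath2 G)"
    using alternating_closed[OF cons_La(1) marking_wreath2[OF cons_La(3)]] .
  hence "wreath_marking G e La \<otimes>\<^bsub>wreath2 G\<^esub> g = (y, x, \<not> s)"
    using h cons_La(3) by (auto simp: marking_def group.is_monoid monoid.l_one)
  then show ?case using h by (intro exI[of _ y] exI[of _ x] exI[of _ "\<not> s"] exI[of _ j] exI[of _ i]) auto
next
  case (cons_V z g n)
  then obtain x y s i j where h: "g = (x, y, s)" "x \<in> weighted_ball G e i" "y \<in> weighted_ball G e j"
    "7 * (i + j) \<le> 6 * n" by auto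
  have g: "g \<in> carrier (wreath2 G)"
    using alternating_closed[OF cons_V(2) marking_wreath2[OF cons_V(4)]] .
  have x1: "\<one>\<^bsub>G\<^esub> \<otimes>\<^bsub>G\<^esub> x = x" using g h(1) cons_V(4) by (auto simp: marking_def group.is_monoid monoid.l_one)
  note cons = weighted_ball_Cons[of _ G e]
  \<comment> \<open>Beyond the inductive bound, \<open>Lb\<close> adds 7(3 + 3) = 42 against 6 * 4 +
    18 = 42, \<open>Lc\<close> adds 7(3 + 2) = 35 against 36, and \<open>Ld\<close> adds 7 * 4 = 28
    against 30.\<close>
  consider "z = Lb" | "z = Lc" | "z = Ld" using cons_V(1) by (cases z) auto
  then show ?case
  proof cases
    case 1
    then show ?thesis using h cons[OF h(2), of La] cons[OF h(3), of Lc]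
      by (intro exI[of _ "e La \<otimes>\<^bsub>G\<^esub> x"] exI[of _ "e Lc \<otimes>\<^bsub>G\<^esub> y"] exI[of _ s] exI[of _ "i + 3"] exI[of _ "j + 3"])
        simp
  next
    case 2
    then show ?thesis using h cons[OF h(2), of La] cons[OF h(3), of Ld]
      by (intro exI[of _ "e La \<otimes>\<^bsub>G\<^esub> x"] exI[of _ "e Ld \<otimes>\<^bsub>G\<^esub> y"] exI[of _ s] exI[of _ "i + 3"] exI[of _ "j + 2"])
        simp
  next
    case 3
    then show ?thesis using h x1 cons[OF h(3), of Lb]
      by (intro exI[of _ x] exI[of _ "e Lb \<otimes>\<^bsub>G\<^esub> y"] exI[of _ s] exI[of _ i] exI[of _ "j + 4"]) simp
  qed
qed

text \<open>By contraction the coordinates lie in balls of radii \<open>i\<close> and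
  \<open>j\<close> with \<open>i + j \<le> M n\<close>. Enlarging \<open>j\<close> to
  \<open>M n - i\<close> leaves a sum over \<open>i\<close> alone, and the factor 2 counts the swap
  bit.\<close>

lemma card_weighted_ball_wreath2:
  assumes "marking G e"
  defines "M \<equiv> \<lambda>n. (6 * n + 18) div 7"
  shows "card (weighted_ball (wreath2 G) (wreath_marking G e) n)
    \<le> 2 * (\<Sum>i\<le>M n. card (weighted_ball G e i) * card (weighted_ball G e (M n - i)))"
proof -
  let ?P = "\<lambda>i. weighted_ball G e i \<times> weighted_ball G e (M n - i) \<times> (UNIV :: bool set)"
  have "weighted_ball (wreath2 G) (wreath_marking G e) n \<subseteq> (\<Union>i\<le>M n. ?P i)"
  proof
    fix g assume "g \<in> weighted_ball (wreath2 G) (wreath_marking G e) n"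
    from weighted_ball_alternating[OF marking_wreath2[OF assms(1)] this]
    obtain b m where m: "m \<le> n" "alternating (wreath2 G) (wreath_marking G e) b g m" by auto
    from alternating_wreath2_contracting[OF m(2) assms(1)]
    obtain x y s i j where h: "g = (x, y, s)" "x \<in> weighted_ball G e i" "y \<in> weighted_ball G e j"
      "7 * (i + j) + (if b then 18 else 0) \<le> 6 * m + 18" by auto
    have ij: "i + j \<le> M n"
    proof -
      have "7 * (i + j) \<le> 6 * n + 18" using h(4) m(1) by (auto split: if_splits)
      thus ?thesis by (simp add: M_def less_eq_div_iff_mult_less_eq)
    qed
    have "j \<le> M n - i" using ij by simp
    hence "y \<in> weighted_ball G e (M n - i)" using h(3) weighted_ball_mono[THEN subsetD] by fastforce
    thus "g \<in> (\<Union>i\<le>M n. ?P i)" using h ij by auto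
  qed
  hence "card (weighted_ball (wreath2 G) (wreath_marking G e) n) \<le> card (\<Union>i\<le>M n. ?P i)"
    by (intro card_mono) (auto intro!: finite_cartesian_product finite_weighted_ball)
  also have "\<dots> \<le> (\<Sum>i\<le>M n. card (?P i))" by (rule card_UN_le) simp
  also have "\<dots> = 2 * (\<Sum>i\<le>M n. card (weighted_ball G e i) * card (weighted_ball G e (M n - i)))"
    by (simp add: card_cartesian_product sum_distrib_left mult_ac)
  finally show ?thesis .
qed

text \<open>The convolution is at most a constant times \<open>(M + 1) * r ^ M\<close> with
  \<open>M\<close> at most (6n + 18)/7. The linear factor is absorbed by \<open>q ^ M\<close> for
  \<open>q = r powr (1 / 20)\<close>, by Bernoulli's inequality. The exponent is then 21/20 of
  \<open>M\<close>: 6/7 times 21/20 is 9/10, and 18/7 times 21/20 is 27/10, rounded up to 3.\<close>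

lemma growth_bounded_wreath2:
  fixes r :: real
  assumes e: "marking G e" and r: "1 < r" and bound: "growth_bounded G e r"
  shows "growth_bounded (wreath2 G) (wreath_marking G e) (r powr (9 / 10))"
proof -
  obtain K where K: "0 < K" "\<And>n. real (card (weighted_ball G e n)) \<le> K * r ^ n"
    using bound unfolding growth_bounded_def by auto
  define q where "q = r powr (1 / 20)"
  have q: "1 < q" using r unfolding q_def by simp
  define c where "c = 1 + 1 / (q - 1)"
  have c: "0 < c" using q by (simp add: c_def add_pos_pos)
  have lin: "real M + 1 \<le> c * q ^ M" for M
  proof -
    have "1 + real M * (q - 1) \<le> q ^ M" using Bernoulli_inequality[of "q - 1" M] q by simp
    hence "real M \<le> q ^ M / (q - 1)" using q by (simp add: field_simps)
    moreover have "1 \<le> q ^ M" using q by simp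
    ultimately show ?thesis by (simp add: c_def algebra_simps)
  qed
  have "real (card (weighted_ball (wreath2 G) (wreath_marking G e) n))
      \<le> (2 * K\<^sup>2 * c * r powr 3) * (r powr (9 / 10)) ^ n" for n
  proof -
    define M where "M = (6 * n + 18) div 7"
    have M: "7 * real M \<le> 6 * real n + 18" unfolding M_def by linarith
    have "real (card (weighted_ball (wreath2 G) (wreath_marking G e) n))
        \<le> 2 * (\<Sum>i\<le>M. real (card (weighted_ball G e i)) * real (card (weighted_ball G e (M - i))))"
      using of_nat_mono[OF card_weighted_ball_wreath2[OF e, of n], where ?'a = real]
      unfolding M_def by simp
    also have "\<dots> \<le> 2 * (\<Sum>i\<le>M. (K * r ^ i) * (K * r ^ (M - i)))"
      using K r by (intro mult_left_mono sum_mono mult_mono) auto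
    also have "\<dots> = 2 * (\<Sum>i\<le>M. K\<^sup>2 * r ^ M)"
      by (simp add: power2_eq_square mult_ac flip: power_add)
    also have "\<dots> = 2 * K\<^sup>2 * ((real M + 1) * r ^ M)" by (simp add: algebra_simps)
    also have "\<dots> \<le> 2 * K\<^sup>2 * ((c * q ^ M) * r ^ M)"
      using lin[of M] r by (intro mult_left_mono mult_right_mono) auto
    also have "\<dots> = 2 * K\<^sup>2 * c * r powr (21 / 20 * real M)"
      using r unfolding q_def by (simp add: powr_powr powr_add [symmetric] flip: powr_realpow)
    also have "\<dots> \<le> 2 * K\<^sup>2 * c * r powr (3 + 9 / 10 * real n)"
      using M r c by (intro mult_left_mono powr_mono) auto
    also have "\<dots> = (2 * K\<^sup>2 * c * r powr 3) * (r powr (9 / 10)) ^ n"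
      using r by (simp add: powr_add powr_power mult.commute[of "real n"])
    finally show ?thesis .
  qed
  moreover have "0 < 2 * K\<^sup>2 * c * r powr 3" using K c r by simp
  ultimately show ?thesis unfolding growth_bounded_def by blast
qed

lemma hom_word_product:
  assumes "group_hom G H f" "\<And>x. e x \<in> carrier G"
  shows "word_product H (map (f \<circ> e) w) = f (word_product G (map e w))"
proof -
  interpret group_hom G H f by fact
  show ?thesis
  proof (induction w)
    case (Cons x w)
    have "set (map e w) \<subseteq> carrier G" using assms(2) by auto
    with Cons show ?case using assms(2)[of x] G.word_product_closed by simp
  qed (simp add: hom_one)
qed

section \<open>The invariant of the iteration and its preservation\<close>

definition admissible :: "'a itself \<Rightarrow> ('g, 'b) monoid_scheme \<Rightarrow> (letter \<Rightarrow> 'g) \<Rightarrow> real \<Rightarrow> bool" where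
  "admissible T G e r \<longleftrightarrow> marking G e \<and> generate G (range e) = carrier G \<and>
     uniformly_exponential G \<and> elementary_amenable_copy T G \<and> growth_bounded G e r"

text \<open>A step of the construction leads from \<open>'a\<close> to triples over
  \<open>'a\<close>. Transport along an injection returns to \<open>'a\<close>, so that the step can
  be repeated.\<close>

lemma admissible_image_group:
  fixes f :: "'g \<Rightarrow> 'a"
  assumes adm: "admissible TYPE('a) G e r" and inj: "inj_on f (carrier G)"
  shows "admissible TYPE('a) (image_group f G) (f \<circ> e) r"
proof -
  have e: "marking G e" and gen: "generate G (range e) = carrier G"
    using adm by (auto simp: admissible_def)
  interpret G: group G using e by (rule marking_group)
  define H where "H = image_group f G"
  have f: "f \<in> iso G H" and grpH: "group H"
    using image_group_iso[OF G.is_group inj] by (auto simp: H_def)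
  interpret f: group_hom G H f
    using f grpH G.is_group by (simp add: group_hom_def group_hom_axioms_def iso_def)
  have carH: "f ` carrier G = carrier H" using f by (simp add: Group.iso_iff)
  note c = marking_closed[OF e]
  have "marking H (f \<circ> e)"
    using e grpH c by (auto simp: marking_def simp flip: f.hom_mult)
  moreover have "generate H (range (f \<circ> e)) = carrier H"
    using f.generate_img[of "range e"] gen carH c by (auto simp: image_comp)
  moreover have "uniformly_exponential H"
  proof (rule uniformly_exponential_hom_image[OF grpH G.is_group])
    have "inv_into (carrier G) f \<in> iso H G" using G.iso_set_sym[OF f] .
    thus "inv_into (carrier G) f \<in> hom H G" "inv_into (carrier G) f ` carrier H = carrier G"
      by (auto simp: Group.iso_iff)
  qed (use adm in \<open>simp add: admissible_def\<close>)
  moreover have "elementary_amenable_copy TYPE('a) H"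
  proof -
    have "elementary_amenable_copy TYPE('a) G" using adm by (simp add: admissible_def)
    moreover have "H \<cong> G" using G.iso_sym is_isoI[OF f] by blast
    ultimately show ?thesis by (rule elementary_amenable_copy_iso)
  qed
  moreover have "growth_bounded H (f \<circ> e) r"
  proof -
    have "weighted_ball H (f \<circ> e) n \<subseteq> f ` weighted_ball G e n" for n
      unfolding weighted_ball_def hom_word_product[of G H f e, OF f.group_hom_axioms c] by blast
    hence "card (weighted_ball H (f \<circ> e) n) \<le> card (weighted_ball G e n)" for n
      using finite_weighted_ball by (rule surj_card_le[rotated])
    moreover obtain K where "0 < K" "\<And>n. real (card (weighted_ball G e n)) \<le> K * r ^ n"
      using adm by (auto simp: admissible_def growth_bounded_def)
    ultimately have "\<forall>n. real (card (weighted_ball H (f \<circ> e) n)) \<le> K * r ^ n"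
      by (meson of_nat_mono order_trans)
    with \<open>0 < K\<close> show ?thesis by (auto simp: growth_bounded_def)
  qed
  ultimately show ?thesis by (simp add: admissible_def H_def)
qed

definition bool_group :: "bool monoid" where
  "bool_group = \<lparr>carrier = UNIV, monoid.mult = (\<noteq>), one = False\<rparr>"

lemma comm_group_bool_group: "comm_group bool_group"
  by (rule comm_groupI) (auto simp: bool_group_def)

text \<open>An infinite set is equinumerous with its square; two distinct elements \<open>u\<close>,
  \<open>v\<close> encode the bit.\<close>

lemma infinite_imp_inj_triple:
  assumes "infinite (UNIV :: 'a set)"
  shows "\<exists>f :: 'a \<times> 'a \<times> bool \<Rightarrow> 'a. inj f"
proof -
  obtain g :: "'a \<times> 'a \<Rightarrow> 'a" where "bij_betw g (UNIV \<times> UNIV) UNIV"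
    using card_of_Times_same_infinite[OF assms] unfolding card_of_ordIso[symmetric] by blast
  hence g: "g p = g q \<longleftrightarrow> p = q" for p q by (simp add: bij_betw_def inj_eq)
  obtain u v :: 'a where uv: "u \<noteq> v" using assms by (metis ex_new_if_finite finite.simps insertI1)
  have "inj (\<lambda>(x, y, s). g (x, g (y, if s then u else v)))"
    using uv by (auto simp: inj_def g split: if_splits)
  thus ?thesis by blast
qed

lemma infinite_imp_inj_bool:
  assumes "infinite (UNIV :: 'a set)"
  shows "\<exists>f :: bool \<Rightarrow> 'a. inj f"
proof -
  obtain f :: "'a \<times> 'a \<times> bool \<Rightarrow> 'a" where f: "inj f" using infinite_imp_inj_triple[OF assms] by blast
  have "inj (\<lambda>s. f (undefined, undefined, s))" by (rule injI) (simp add: inj_eq[OF f])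
  thus ?thesis by (intro exI[of _ "\<lambda>s. f (undefined, undefined, s)"])
qed

text \<open>Two extensions: the kernel \<open>N\<close> of the swap bit is the direct square of
  \<open>G\<close>, and the kernel of the first projection of \<open>N\<close> is again a copy of
  \<open>G\<close>.\<close>

lemma elementary_amenable_copy_wreath2:
  fixes G :: "'a monoid"
  assumes inf: "infinite (UNIV :: 'a set)" and G: "group G" "elementary_amenable_copy TYPE('a) G"
  shows "elementary_amenable_copy TYPE('a) (wreath2 G)"
proof -
  interpret G: group G by fact
  interpret W: group "wreath2 G" by (rule group_wreath2[OF G(1)])
  obtain f :: "'a \<times> 'a \<times> bool \<Rightarrow> 'a" where f: "inj f" using infinite_imp_inj_triple[OF inf] by blast
  obtain f2 :: "bool \<Rightarrow> 'a" where f2: "inj f2" using infinite_imp_inj_bool[OF inf] by blast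
  have B: "group bool_group" using comm_group_bool_group by (simp add: comm_group_def)
  let ?\<phi> = "\<lambda>(x, y, s). s"
  have \<phi>: "?\<phi> \<in> hom (wreath2 G) bool_group"
    by (auto simp: hom_def bool_group_def wreath2_def)
  have ker: "kernel (wreath2 G) bool_group ?\<phi> = carrier G \<times> carrier G \<times> {False}"
    by (auto simp: kernel_def bool_group_def)
  interpret \<phi>: group_hom "wreath2 G" bool_group ?\<phi>
    using \<phi> B W.is_group by (simp add: group_hom_def group_hom_axioms_def)
  define N where "N = (wreath2 G)\<lparr>carrier := carrier G \<times> carrier G \<times> {False}\<rparr>"
  have N: "group N"
    unfolding N_def ker[symmetric] using W.subgroup_imp_group[OF \<phi>.subgroup_kernel] .
  have fst: "fst \<in> hom N G" by (auto simp: hom_def N_def)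
  have kfst: "kernel N G fst = {\<one>\<^bsub>G\<^esub>} \<times> carrier G \<times> {False}"
    by (auto simp: kernel_def N_def)
  have "(\<lambda>x. fst (snd x)) \<in> iso (N\<lparr>carrier := kernel N G fst\<rparr>) G"
    unfolding kfst by (auto simp: iso_def hom_def N_def bij_betw_def inj_on_def image_iff)
  hence "elementary_amenable_copy TYPE('a) (N\<lparr>carrier := kernel N G fst\<rparr>)"
    using elementary_amenable_copy_iso[OF G(2)] is_isoI by blast
  moreover have "fst ` carrier N = carrier G" by (auto simp: N_def image_iff)
  moreover have "inj_on f (carrier N)" using f by (rule inj_on_subset) simp
  ultimately have "elementary_amenable_copy TYPE('a) N"
    using elementary_amenable_copy_extension[OF N _ G(1) fst] G(2) by blast
  hence "elementary_amenable_copy TYPE('a) ((wreath2 G)\<lparr>carrier := kernel (wreath2 G) bool_group ?\<phi>\<rparr>)"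
    by (simp only: N_def ker)
  moreover have "?\<phi> ` carrier (wreath2 G) = carrier bool_group"
  proof -
    have "s \<in> ?\<phi> ` carrier (wreath2 G)" for s by (rule image_eqI[of _ _ "(\<one>\<^bsub>G\<^esub>, \<one>\<^bsub>G\<^esub>, s)"]) auto
    thus ?thesis by (auto simp: bool_group_def)
  qed
  moreover have "inj_on f (carrier (wreath2 G))" using f by (rule inj_on_subset) simp
  moreover have "elementary_amenable_copy TYPE('a) bool_group"
    using elementary_amenable_copy_comm[OF comm_group_bool_group inj_on_subset[OF f2]] by simp
  ultimately show ?thesis
    using elementary_amenable_copy_extension[OF W.is_group _ B \<phi>] by blast
qed

text \<open>On the subgroup \<open>K\<close> of elements that do not swap, the first coordinate is a
  homomorphism. Its image contains all generators of \<open>G\<close>, so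
  \<open>uniformly_exponential_index_two\<close> applies with \<open>Q = G\<close>.\<close>

lemma uniformly_exponential_wreath2_subgroup:
  assumes e: "marking G e" and gen: "generate G (range e) = carrier G" and "uniformly_exponential G"
  defines "H \<equiv> generate (wreath2 G) (range (wreath_marking G e))"
  shows "uniformly_exponential ((wreath2 G)\<lparr>carrier := H\<rparr>)"
proof -
  interpret G: group G using e by (rule marking_group)
  interpret W: group "wreath2 G" by (rule group_wreath2[OF G.is_group])
  note e' = marking_wreath2[OF e]
  have H: "subgroup H (wreath2 G)"
    unfolding H_def using e' by (intro W.generate_is_subgroup) (simp add: marking_def)
  interpret H: group "(wreath2 G)\<lparr>carrier := H\<rparr>" using W.subgroup_imp_group[OF H] .
  define s :: "'a \<times> 'a \<times> bool \<Rightarrow> bool" where "s = (\<lambda>(x, y, s). s)"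
  define K where "K = {g \<in> H. \<not> s g}"
  have Hc: "H \<subseteq> carrier (wreath2 G)" using subgroup.subset[OF H] .
  have s_mult: "s (g \<otimes>\<^bsub>wreath2 G\<^esub> h) \<longleftrightarrow> s g \<noteq> s h" for g h
    by (cases g; cases h) (auto simp: s_def wreath2_def)
  have "subgroup K ((wreath2 G)\<lparr>carrier := H\<rparr>)"
    using H.subgroup_index_two[of s] s_mult by (simp add: K_def)
  hence K: "subgroup K (wreath2 G)" by (rule W.incl_subgroup[OF H])
  have fst: "fst \<in> hom ((wreath2 G)\<lparr>carrier := K\<rparr>) G"
    using Hc by (fastforce simp: hom_def K_def s_def)
  interpret fst: group_hom "(wreath2 G)\<lparr>carrier := K\<rparr>" G fst
    by (rule group_hom_restrictI[OF W.is_group K G.is_group fst])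
  have "carrier G \<subseteq> fst ` K"
  proof -
    have sub: "subgroup (fst ` K) G"
      using fst.subgroup_img_is_subgroup[OF fst.G.subgroup_self] by simp
    let ?e = "wreath_marking G e"
    have gens: "?e x \<in> H" for x unfolding H_def by (rule generate.incl) simp
    note c = marking_closed[OF e]
    have "e La \<in> fst ` K" using gens[of Lb] by (force simp: K_def s_def)
    \<comment> \<open>Conjugation by the swap exchanges the coordinates and so exposes the second
      coordinates \<open>c\<close>, \<open>d\<close>, \<open>b\<close> of the generators.\<close>
    moreover have conj: "?e La \<otimes>\<^bsub>wreath2 G\<^esub> ?e x \<otimes>\<^bsub>wreath2 G\<^esub> ?e La \<in> H" for x
      using gens subgroup.m_closed[OF H] by blast
    have "e Lc \<in> fst ` K" using conj[of Lb] c by (force simp: K_def s_def)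
    moreover have "e Ld \<in> fst ` K" using conj[of Lc] c by (force simp: K_def s_def)
    moreover have "e Lb \<in> fst ` K" using conj[of Ld] c by (force simp: K_def s_def)
    ultimately have "e x \<in> fst ` K" for x by (cases x) auto
    hence "range e \<subseteq> fst ` K" by blast
    from G.generate_subgroup_incl[OF this sub] show ?thesis using gen by simp
  qed
  moreover have "fst ` K \<subseteq> carrier G" using Hc by (auto simp: K_def)
  ultimately have surj: "fst ` K = carrier G" by blast
  show ?thesis
    by (rule H.uniformly_exponential_index_two[OF G.is_group, of s K fst])
      (use s_mult fst surj assms(3) in \<open>auto simp: K_def\<close>)
qed

lemma admissible_step:
  fixes G :: "'a monoid"
  assumes inf: "infinite (UNIV :: 'a set)" and adm: "admissible TYPE('a) G e r" and r: "1 < r"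
  shows "\<exists>(H :: 'a monoid) e'. admissible TYPE('a) H e' (r powr (9 / 10))"
proof -
  have e: "marking G e" and gen: "generate G (range e) = carrier G" and ue: "uniformly_exponential G"
    and ea: "elementary_amenable_copy TYPE('a) G" and gb: "growth_bounded G e r"
    using adm by (auto simp: admissible_def)
  interpret G: group G using e by (rule marking_group)
  interpret W: group "wreath2 G" by (rule group_wreath2[OF G.is_group])
  let ?e = "wreath_marking G e"
  define H where "H = generate (wreath2 G) (range ?e)"
  define P where "P = (wreath2 G)\<lparr>carrier := H\<rparr>"
  have e': "marking (wreath2 G) ?e" using marking_wreath2[OF e] .
  have rng: "range ?e \<subseteq> H" unfolding H_def by (rule subsetI) (rule generate.incl)
  have H: "subgroup H (wreath2 G)"
    unfolding H_def using e' by (intro W.generate_is_subgroup) (simp add: marking_def)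
  \<comment> \<open>Products do not depend on the carrier, so the growth bound in the full wreath
    product holds verbatim in the generated subgroup.\<close>
  have wp: "word_product P = word_product (wreath2 G)" by (simp add: P_def word_product_def fun_eq_iff)
  have "marking P ?e"
    using e' rng W.subgroup_imp_group[OF H] unfolding marking_def P_def by simp
  moreover have "generate P (range ?e) = carrier P"
    unfolding P_def using W.generate_consistent[OF rng H] by (simp add: H_def)
  moreover have "uniformly_exponential P"
    unfolding P_def H_def using uniformly_exponential_wreath2_subgroup[OF e gen ue] .
  moreover have "elementary_amenable_copy TYPE('a) P"
    unfolding P_def
    using elementary_amenable_copy_subgroup[OF elementary_amenable_copy_wreath2[OF inf G.is_group ea] W.is_group H] .
  moreover have "growth_bounded P ?e (r powr (9 / 10))"
    using growth_bounded_wreath2[OF e r gb] unfolding growth_bounded_def weighted_ball_def wp .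
  ultimately have "admissible TYPE('a) P ?e (r powr (9 / 10))" by (simp add: admissible_def)
  moreover obtain f :: "'a \<times> 'a \<times> bool \<Rightarrow> 'a" where "inj f" using infinite_imp_inj_triple[OF inf] by blast
  ultimately show ?thesis using admissible_image_group inj_on_subset by blast
qed

section \<open>The initial group\<close>

definition reflect :: "bool \<Rightarrow> int \<Rightarrow> int" where
  "reflect s i = (if s then - i else i)"

text \<open>The wreath product of \<open>\<int>/2\<close> by the isometry group of \<open>\<int>\<close>: the triple \<open>(f, s, i)\<close> is the lamp
  configuration \<open>f\<close> together with the isometry \<open>x \<mapsto> reflect s x + i\<close>, whose inverse is
  \<open>x \<mapsto> reflect s (x - i)\<close>.\<close>

definition lamp_group :: "((int \<Rightarrow> bool) \<times> bool \<times> int) monoid" where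
  "lamp_group = \<lparr>carrier = {f. finite (Collect f)} \<times> UNIV \<times> UNIV,
     monoid.mult = (\<lambda>(f, s, i) (g, t, j). (\<lambda>x. f x \<noteq> g (reflect s (x - i)), s \<noteq> t, reflect s j + i)),
     one = (\<lambda>_. False, False, 0)\<rparr>"

text \<open>\<open>La\<close> and \<open>Lc\<close> are the reflections of the line that send
  \<open>x\<close> to \<open>1 - x\<close> and to \<open>- x\<close>; their product
  \<open>La Lc\<close> is the translation by 1. \<open>Ld\<close> switches the lamp at 0, which
  \<open>Lc\<close> fixes, so the two commute and \<open>Lb\<close> is their product.\<close>

fun lamp_marking :: "letter \<Rightarrow> (int \<Rightarrow> bool) \<times> bool \<times> int" where
  "lamp_marking La = (\<lambda>_. False, True, 1)"
| "lamp_marking Lb = (\<lambda>x. x = 0, True, 0)"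
| "lamp_marking Lc = (\<lambda>_. False, True, 0)"
| "lamp_marking Ld = (\<lambda>x. x = 0, False, 0)"

lemma lamp_group_simps [simp]:
  "carrier lamp_group = {f. finite (Collect f)} \<times> UNIV \<times> UNIV"
  "\<one>\<^bsub>lamp_group\<^esub> = (\<lambda>_. False, False, 0)"
  "(f, s, i) \<otimes>\<^bsub>lamp_group\<^esub> (g, t, j) = (\<lambda>x. f x \<noteq> g (reflect s (x - i)), s \<noteq> t, reflect s j + i)"
  by (simp_all add: lamp_group_def)

lemma finite_lamp_mult:
  assumes "finite (Collect f)" "finite (Collect g)"
  shows "finite {x. f x \<noteq> g (reflect s (x - i))}"
proof (rule finite_subset)
  show "{x. f x \<noteq> g (reflect s (x - i))} \<subseteq> Collect f \<union> (\<lambda>y. reflect s y + i) ` Collect g"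
  proof
    fix x assume "x \<in> {x. f x \<noteq> g (reflect s (x - i))}"
    moreover have "x = reflect s (reflect s (x - i)) + i" by (simp add: reflect_def)
    ultimately show "x \<in> Collect f \<union> (\<lambda>y. reflect s y + i) ` Collect g" by blast
  qed
qed (use assms in auto)

lemma group_lamp_group: "group lamp_group"
proof (rule groupI)
  fix u v assume "u \<in> carrier lamp_group" "v \<in> carrier lamp_group"
  then obtain f s i g t j where "u = (f, s, i)" "v = (g, t, j)" "finite (Collect f)" "finite (Collect g)"
    by auto
  then show "u \<otimes>\<^bsub>lamp_group\<^esub> v \<in> carrier lamp_group" using finite_lamp_mult[of f g s i] by simp
next
  fix u v w
  show "u \<otimes>\<^bsub>lamp_group\<^esub> v \<otimes>\<^bsub>lamp_group\<^esub> w = u \<otimes>\<^bsub>lamp_group\<^esub> (v \<otimes>\<^bsub>lamp_group\<^esub> w)"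
    by (cases u; cases v; cases w) (auto simp: reflect_def fun_eq_iff algebra_simps)
next
  fix u
  show "\<one>\<^bsub>lamp_group\<^esub> \<otimes>\<^bsub>lamp_group\<^esub> u = u" by (cases u) (simp add: reflect_def)
next
  fix u assume u: "u \<in> carrier lamp_group"
  obtain f s i where fsi: "u = (f, s, i)" by (cases u) auto
  have "finite {x. False \<noteq> f (reflect s (x - (- reflect s i)))}"
    by (rule finite_lamp_mult) (use u fsi in auto)
  hence "(\<lambda>x. f (reflect s (x + reflect s i)), s, - reflect s i) \<in> carrier lamp_group" by simp
  moreover have "(\<lambda>x. f (reflect s (x + reflect s i)), s, - reflect s i) \<otimes>\<^bsub>lamp_group\<^esub> u = \<one>\<^bsub>lamp_group\<^esub>"
    by (simp add: fsi)
  ultimately show "\<exists>v\<in>carrier lamp_group. v \<otimes>\<^bsub>lamp_group\<^esub> u = \<one>\<^bsub>lamp_group\<^esub>" by blast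
qed simp

lemma marking_lamp_group: "marking lamp_group lamp_marking"
proof -
  have "lamp_marking x \<in> carrier lamp_group" for x by (cases x) auto
  hence "range lamp_marking \<subseteq> carrier lamp_group" by blast
  thus ?thesis using group_lamp_group by (auto simp: marking_def reflect_def fun_eq_iff)
qed

text \<open>The carrier is countable and hence embeds into any infinite type. Amenability takes two
  extensions: the orientation bit has kernel \<open>N\<close>, and the translation part maps
  \<open>N\<close> onto the integers with the abelian group of lamp configurations as
  kernel.\<close>

lemma elementary_amenable_copy_lamp_group:
  assumes inf: "infinite (UNIV :: 'a set)"
  shows "\<exists>f :: (int \<Rightarrow> bool) \<times> bool \<times> int \<Rightarrow> 'a. inj_on f (carrier lamp_group)"
    and "elementary_amenable_copy TYPE('a) lamp_group"
proof -
  interpret L: group lamp_group by (rule group_lamp_group)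
  obtain h :: "nat \<Rightarrow> 'a" where h: "inj h" using infinite_countable_subset[OF inf] by blast
  obtain f2 :: "bool \<Rightarrow> 'a" where f2: "inj f2" using infinite_imp_inj_bool[OF inf] by blast
  have "countable (carrier lamp_group)"
  proof -
    have "countable {A :: int set. finite A}" by (rule countable_Collect_finite)
    hence "countable ((\<lambda>A x. x \<in> A) ` {A :: int set. finite A})" by (rule countable_image)
    moreover have "{f :: int \<Rightarrow> bool. finite (Collect f)} \<subseteq> (\<lambda>A x. x \<in> A) ` {A. finite A}"
      by (auto simp: image_iff intro!: exI[of _ "Collect f" for f])
    ultimately have "countable {f :: int \<Rightarrow> bool. finite (Collect f)}" by (rule countable_subset[rotated])
    thus ?thesis by auto
  qed
  then obtain n :: "(int \<Rightarrow> bool) \<times> bool \<times> int \<Rightarrow> nat" where n: "inj_on n (carrier lamp_group)"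
    using countableE by blast
  have f: "inj_on (h \<circ> n) (carrier lamp_group)"
    using n inj_on_subset[OF h] by (intro comp_inj_on) auto
  thus "\<exists>f :: (int \<Rightarrow> bool) \<times> bool \<times> int \<Rightarrow> 'a. inj_on f (carrier lamp_group)" by blast
  have B: "group bool_group" using comm_group_bool_group by (simp add: comm_group_def)
  let ?\<phi> = "\<lambda>(f, s, i). s"
  have \<phi>: "?\<phi> \<in> hom lamp_group bool_group" by (auto simp: hom_def bool_group_def)
  have ker: "kernel lamp_group bool_group ?\<phi> = {f. finite (Collect f)} \<times> {False} \<times> UNIV"
    by (auto simp: kernel_def bool_group_def)
  interpret \<phi>: group_hom lamp_group bool_group ?\<phi>
    using \<phi> B L.is_group by (simp add: group_hom_def group_hom_axioms_def)
  define N where "N = lamp_group\<lparr>carrier := {f. finite (Collect f)} \<times> {False} \<times> UNIV\<rparr>"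
  have N: "group N"
    unfolding N_def ker[symmetric] using L.subgroup_imp_group[OF \<phi>.subgroup_kernel] .
  have fN: "inj_on (h \<circ> n) (carrier N)" using f by (rule inj_on_subset) (auto simp: N_def)
  let ?\<psi> = "\<lambda>(f, s, i). i"
  have \<psi>: "?\<psi> \<in> hom N integer_group" by (auto simp: hom_def N_def reflect_def integer_group_def)
  have kerN: "kernel N integer_group ?\<psi> = {f. finite (Collect f)} \<times> {False} \<times> {0}"
    by (auto simp: kernel_def N_def)
  interpret \<psi>: group_hom N integer_group ?\<psi>
    using \<psi> N by (simp add: group_hom_def group_hom_axioms_def)
  have "comm_group (N\<lparr>carrier := kernel N integer_group ?\<psi>\<rparr>)"
  proof (rule group.group_comm_groupI)
    show "group (N\<lparr>carrier := kernel N integer_group ?\<psi>\<rparr>)"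
      using \<psi>.G.subgroup_imp_group[OF \<psi>.subgroup_kernel] .
  qed (unfold kerN, auto simp: N_def reflect_def fun_eq_iff)
  moreover have "inj_on (h \<circ> n) (carrier (N\<lparr>carrier := kernel N integer_group ?\<psi>\<rparr>))"
    using fN by (rule inj_on_subset) (auto simp: kernel_def)
  ultimately have "elementary_amenable_copy TYPE('a) (N\<lparr>carrier := kernel N integer_group ?\<psi>\<rparr>)"
    by (rule elementary_amenable_copy_comm)
  moreover have "elementary_amenable_copy TYPE('a) integer_group"
  proof (rule elementary_amenable_copy_comm[of _ "h \<circ> to_nat"])
    show "comm_group integer_group"
      by (rule group.group_comm_groupI[OF group_integer_group]) (simp add: integer_group_def)
    show "inj_on (h \<circ> to_nat) (carrier integer_group)"
      using inj_on_subset[OF h] by (intro comp_inj_on) auto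
  qed
  moreover have "?\<psi> ` carrier N = carrier integer_group"
    by (auto simp: N_def image_iff intro: exI[of _ "\<lambda>_. False"])
  ultimately have "elementary_amenable_copy TYPE('a) N"
    using elementary_amenable_copy_extension[OF N fN group_integer_group \<psi>] by blast
  hence "elementary_amenable_copy TYPE('a) (lamp_group\<lparr>carrier := kernel lamp_group bool_group ?\<phi>\<rparr>)"
    by (simp only: N_def ker)
  moreover have "?\<phi> ` carrier lamp_group = carrier bool_group"
    by (auto simp: image_iff bool_group_def intro: exI[of _ "\<lambda>_. False"])
  moreover have "elementary_amenable_copy TYPE('a) bool_group"
    using elementary_amenable_copy_comm[OF comm_group_bool_group inj_on_subset[OF f2]] by simp
  ultimately show "elementary_amenable_copy TYPE('a) lamp_group"
    using elementary_amenable_copy_extension[OF L.is_group f B \<phi>] by blast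
qed

text \<open>If \<open>u\<close> has lamps \<open>f\<close> and \<open>x\<close> translates by \<open>k\<close>, a product of \<open>n\<close> factors, \<open>u x\<close> for \<open>True\<close> and
  \<open>x\<close> for \<open>False\<close>, has the lamps \<open>lamp_sum f k bs\<close> on top of those of \<open>x\<^sup>n\<close>.\<close>

fun lamp_sum :: "(int \<Rightarrow> bool) \<Rightarrow> int \<Rightarrow> bool list \<Rightarrow> int \<Rightarrow> bool" where
  "lamp_sum f k [] = (\<lambda>_. False)"
| "lamp_sum f k (b # bs) = (\<lambda>x. (b \<and> f x) \<noteq> lamp_sum f k bs (x - k))"

text \<open>At the leftmost lamp \<open>m\<close> of \<open>f\<close> only the first factor is
  visible, because later factors are shifted to the right by multiples of \<open>k\<close>. This
  recovers the first bit, and induction recovers the others.\<close>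

lemma lamp_sum_inj:
  assumes f: "finite (Collect f)" "f z" and k: "0 < k"
  assumes "length bs = length cs" "lamp_sum f k bs = lamp_sum f k cs"
  shows "bs = cs"
proof -
  define m where "m = Min (Collect f)"
  have m: "f m" using Min_in[OF f(1)] f(2) by (auto simp: m_def)
  have below: "\<not> f x" if "x < m" for x using Min_le[OF f(1), of x] that by (auto simp: m_def)
  have zero: "\<not> lamp_sum f k bs x" if "x < m" for bs x
    using that by (induction bs arbitrary: x) (use below k in auto)
  show ?thesis
    using assms(4,5)
  proof (induction bs cs rule: list_induct2)
    case (Cons b bs c cs)
    have "(b \<and> f x) \<noteq> lamp_sum f k bs (x - k) \<longleftrightarrow> (c \<and> f x) \<noteq> lamp_sum f k cs (x - k)" for x
      using fun_cong[OF Cons.prems, of x] by simp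
    note eq = this
    have bc: "b = c" using eq[of m] zero[of "m - k"] m k by simp
    have "lamp_sum f k bs x = lamp_sum f k cs x" for x using eq[of "x + k"] bc by auto
    thus ?case using bc Cons.IH by auto
  qed simp
qed

lemma (in group) generate_commute:
  assumes x: "x \<in> carrier G" and X: "X \<subseteq> carrier G" and comm: "\<And>y. y \<in> X \<Longrightarrow> x \<otimes> y = y \<otimes> x"
    and g: "g \<in> generate G X"
  shows "x \<otimes> g = g \<otimes> x"
  using g
proof induction
  case (inv y)
  hence y: "y \<in> carrier G" using X by auto
  have "x \<otimes> inv y = inv y \<otimes> (y \<otimes> x) \<otimes> inv y" using x y by (simp flip: m_assoc)
  also have "\<dots> = inv y \<otimes> (x \<otimes> y) \<otimes> inv y" by (simp only: comm[OF inv])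
  also have "\<dots> = inv y \<otimes> x" using x y by (simp add: m_assoc)
  finally show ?case .
next
  case (eng h1 h2)
  hence "h1 \<in> carrier G" "h2 \<in> carrier G" using generate_incl[OF X] by auto
  thus ?case using eng.IH x by (metis m_assoc)
qed (use x comm in auto)

text \<open>Some generator translates, since \<open>K\<close> contains a translation by 1, and some
  generator \<open>y\<close> fails to commute with it, since the lamp at 0 does. The commutator
  \<open>u\<close> has length at most 4, so \<open>u x\<close> has length at most 5, which is the
  constant \<open>k\<close>.\<close>

lemma uniformly_exponential_lamplighter:
  assumes K: "subgroup K lamp_group" and shift: "\<And>f s i. (f, s, i) \<in> K \<Longrightarrow> \<not> s"
    and d: "lamp_marking Ld \<in> K" and t: "(g, False, 1) \<in> K"
  shows "uniformly_exponential (lamp_group\<lparr>carrier := K\<rparr>)"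
proof -
  interpret L: group lamp_group by (rule group_lamp_group)
  define M where "M = lamp_group\<lparr>carrier := K\<rparr>"
  interpret M: group M unfolding M_def using L.subgroup_imp_group[OF K] .
  have carM [simp]: "carrier M = K" and oneM [simp]: "\<one>\<^bsub>M\<^esub> = (\<lambda>_. False, False, 0)" by (simp_all add: M_def)
  have KE: "\<exists>f i. g = (f, False, i) \<and> finite (Collect f)" if "g \<in> K" for g
    using shift that subgroup.subset[OF K] by (cases g) fastforce
  have mult: "(f, False, i) \<otimes>\<^bsub>M\<^esub> (g, False, j) = (\<lambda>x. f x \<noteq> g (x - i), False, i + j)" for f g i j
    by (simp add: M_def reflect_def add.commute)
  define sh :: "(int \<Rightarrow> bool) \<times> bool \<times> int \<Rightarrow> int" where "sh = (\<lambda>(f, s, i). i)"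
  have sh_mult: "sh (g \<otimes>\<^bsub>M\<^esub> h) = sh g + sh h" if gh: "g \<in> K" "h \<in> K" for g h
    using KE[OF gh(1)] KE[OF gh(2)] by (auto simp: mult sh_def)
  have sh_inv: "sh (inv\<^bsub>M\<^esub> g) = - sh g" if g: "g \<in> K" for g
  proof -
    have "sh (inv\<^bsub>M\<^esub> g) + sh g = sh \<one>\<^bsub>M\<^esub>" using sh_mult[of "inv\<^bsub>M\<^esub> g" g] M.inv_closed[of g] M.l_inv[of g] g by simp
    thus ?thesis by (simp add: sh_def)
  qed
  have "2 ^ n \<le> card (word_ball M X (5 * n))" if gen: "finite_generating_set M X" for X n
  proof -
    have X: "finite X" "X \<subseteq> carrier M" "generate M X = K"
      using gen by (auto simp: finite_generating_set_def)
    have "\<exists>x\<in>X. sh x \<noteq> 0"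
    proof (rule ccontr)
      assume c: "\<not> (\<exists>x\<in>X. sh x \<noteq> 0)"
      have "sh g = 0" if "g \<in> generate M X" for g
        using that
      proof induction
        case (eng h1 h2)
        then show ?case using sh_mult X(3) by simp
      next
        case (inv h)
        then show ?case using c sh_inv[of h] X(2) by auto
      qed (use c in \<open>auto simp: sh_def\<close>)
      from this[of "(g, False, 1)"] show False using t X(3) by (simp add: sh_def)
    qed
    then obtain x0 where x0: "x0 \<in> X" "sh x0 \<noteq> 0" by blast
    have x0b: "x0 \<in> word_ball M X 1" using M.incl_word_ball[OF X(2) x0(1)] by simp
    \<comment> \<open>Passing to the inverse if necessary makes the translation positive, as
      \<open>lamp_sum_inj\<close> requires.\<close>
    define x where "x = (if 0 < sh x0 then x0 else inv\<^bsub>M\<^esub> x0)"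
    have xb: "x \<in> word_ball M X 1" using x0b M.word_ball_inv[OF X(2) x0b] by (simp add: x_def)
    have xK: "x \<in> K" using xb M.word_ball_subset[OF X(2), of 1] by auto
    have xpos: "0 < sh x" using x0 sh_inv[of x0] X(2) by (auto simp: x_def)
    obtain fx k where fx: "x = (fx, False, k)" using KE[OF xK] by blast
    have k: "0 < k" using xpos by (simp add: fx sh_def)
    have "\<exists>y\<in>X. x \<otimes>\<^bsub>M\<^esub> y \<noteq> y \<otimes>\<^bsub>M\<^esub> x"
    proof (rule ccontr)
      assume c: "\<not> (\<exists>y\<in>X. x \<otimes>\<^bsub>M\<^esub> y \<noteq> y \<otimes>\<^bsub>M\<^esub> x)"
      have "x \<otimes>\<^bsub>M\<^esub> lamp_marking Ld = lamp_marking Ld \<otimes>\<^bsub>M\<^esub> x"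
        by (rule M.generate_commute[OF _ X(2)]) (use c d xK X(3) in auto)
      hence "(\<lambda>z. fx z \<noteq> (z - k = 0)) = (\<lambda>z. (z = 0) \<noteq> fx (z - 0))" by (simp add: fx mult)
      \<comment> \<open>At position 0 the left side is \<open>fx 0\<close> and the right side its
        negation.\<close>
      from fun_cong[OF this, of 0] show False using k by simp
    qed
    then obtain y where y: "y \<in> X" "x \<otimes>\<^bsub>M\<^esub> y \<noteq> y \<otimes>\<^bsub>M\<^esub> x" by blast
    have yc: "y \<in> carrier M" and xc: "x \<in> carrier M" using y X(2) xK by auto
    define u where "u = x \<otimes>\<^bsub>M\<^esub> y \<otimes>\<^bsub>M\<^esub> inv\<^bsub>M\<^esub> x \<otimes>\<^bsub>M\<^esub> inv\<^bsub>M\<^esub> y"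
    have yb: "y \<in> word_ball M X 1" using M.incl_word_ball[OF X(2) y(1)] by simp
    have ub: "u \<in> word_ball M X 4"
    proof -
      have "u \<in> word_ball M X (1 + 1 + 1 + 1)"
        unfolding u_def by (intro M.word_ball_mult[OF X(2)] M.word_ball_inv[OF X(2)] xb yb)
      thus ?thesis by (simp add: eval_nat_numeral)
    qed
    have uK: "u \<in> K" using ub M.word_ball_subset[OF X(2), of 4] by auto
    have "sh u = 0" using xc yc by (simp add: u_def sh_mult sh_inv flip: carM)
    then obtain f where f: "u = (f, False, 0)" "finite (Collect f)"
      using KE[OF uK] by (auto simp: sh_def)
    have "u \<noteq> \<one>\<^bsub>M\<^esub>"
    proof
      assume "u = \<one>\<^bsub>M\<^esub>"
      hence "(x \<otimes>\<^bsub>M\<^esub> y) \<otimes>\<^bsub>M\<^esub> inv\<^bsub>M\<^esub> (y \<otimes>\<^bsub>M\<^esub> x) = \<one>\<^bsub>M\<^esub>"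
        unfolding u_def using xc yc by (simp only: M.inv_mult_group M.m_assoc M.m_closed M.inv_closed)
      hence "x \<otimes>\<^bsub>M\<^esub> y = y \<otimes>\<^bsub>M\<^esub> x"
        using xc yc by (metis M.inv_closed M.inv_equality M.inv_inv M.m_closed)
      thus False using y(2) by simp
    qed
    then obtain z where z: "f z" by (auto simp: f fun_eq_iff)
    define p where "p bs = foldr (\<lambda>b q. (if b then u \<otimes>\<^bsub>M\<^esub> x else x) \<otimes>\<^bsub>M\<^esub> q) bs \<one>\<^bsub>M\<^esub>" for bs
    have p_ball: "p bs \<in> word_ball M X (5 * length bs)" for bs
    proof (induction bs)
      case Nil
      show ?case unfolding p_def using M.one_in_word_ball by simp
    next
      case (Cons b bs)
      have "u \<otimes>\<^bsub>M\<^esub> x \<in> word_ball M X 5" using M.word_ball_mult[OF X(2) ub xb] by simp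
      moreover have "x \<in> word_ball M X 5" using xb M.word_ball_mono[of 1 5 X] by auto
      ultimately have "(if b then u \<otimes>\<^bsub>M\<^esub> x else x) \<in> word_ball M X 5" by simp
      from M.word_ball_mult[OF X(2) this Cons] show ?case by (simp add: p_def)
    qed
    \<comment> \<open>\<open>c n\<close> is the \<open>n\<close>-th power of \<open>x\<close>,
      folded in parallel with \<open>p\<close>. It depends on the length only, so its lamps cancel
      when lists of equal length are compared.\<close>
    define c where "c n = foldr (\<lambda>_ q. x \<otimes>\<^bsub>M\<^esub> q) (replicate n ()) \<one>\<^bsub>M\<^esub>" for n
    have p_eq: "\<exists>h i. c (length bs) = (h, False, i) \<and> p bs = (\<lambda>x. lamp_sum f k bs x \<noteq> h x, False, i)" for bs
    proof (induction bs)
      case Nil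
      show ?case by (simp add: c_def p_def)
    next
      case (Cons b bs)
      then obtain h i where IH: "c (length bs) = (h, False, i)"
        "p bs = (\<lambda>x. lamp_sum f k bs x \<noteq> h x, False, i)" by auto
      define h' where "h' = (\<lambda>z. fx z \<noteq> h (z - k))"
      have "c (length (b # bs)) = x \<otimes>\<^bsub>M\<^esub> c (length bs)" by (simp add: c_def)
      hence 1: "c (length (b # bs)) = (h', False, k + i)" by (simp only: IH(1) fx mult h'_def)
      have "(if b then u \<otimes>\<^bsub>M\<^esub> x else x) = (\<lambda>z. (b \<and> f z) \<noteq> fx z, False, k)"
        by (simp add: fx f(1) mult)
      moreover have "p (b # bs) = (if b then u \<otimes>\<^bsub>M\<^esub> x else x) \<otimes>\<^bsub>M\<^esub> p bs" by (simp add: p_def)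
      ultimately have "p (b # bs)
          = (\<lambda>z. ((b \<and> f z) \<noteq> fx z) \<noteq> (lamp_sum f k bs (z - k) \<noteq> h (z - k)), False, k + i)"
        by (simp only: IH(2) mult)
      also have "\<dots> = (\<lambda>z. lamp_sum f k (b # bs) z \<noteq> h' z, False, k + i)"
        unfolding h'_def lamp_sum.simps by (auto simp: fun_eq_iff)
      finally show ?case using 1 by blast
    qed
    have inj: "inj_on p {bs. length bs = n}"
    proof (rule inj_onI)
      fix bs cs assume bc: "bs \<in> {bs. length bs = n}" "cs \<in> {bs. length bs = n}" "p bs = p cs"
      obtain h i where 1: "c n = (h, False, i)" "p bs = (\<lambda>x. lamp_sum f k bs x \<noteq> h x, False, i)"
        using p_eq[of bs] bc by auto
      have 2: "p cs = (\<lambda>x. lamp_sum f k cs x \<noteq> h x, False, i)" using p_eq[of cs] bc 1(1) by auto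
      have "lamp_sum f k bs x = lamp_sum f k cs x" for x
      proof -
        have "(lamp_sum f k bs x \<noteq> h x) = (lamp_sum f k cs x \<noteq> h x)"
          using bc(3) unfolding 1 2 by (simp add: fun_eq_iff)
        thus ?thesis by auto
      qed
      thus "bs = cs" using lamp_sum_inj[OF f(2) z k, of bs cs] bc by auto
    qed
    have "2 ^ n = card {bs :: bool list. length bs = n}"
      using card_lists_length_eq[of "UNIV :: bool set" n] by simp
    also have "\<dots> = card (p ` {bs. length bs = n})" using card_image[OF inj] by simp
    also have "\<dots> \<le> card (word_ball M X (5 * n))"
      using p_ball M.finite_word_ball[OF X(1)] by (intro card_mono) auto
    finally show ?thesis .
  qed
  thus ?thesis unfolding uniformly_exponential_def M_def by (intro exI[of _ 5]) auto
qed

section \<open>Start of the iteration and conclusion\<close>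

lemma admissible_lamp_group:
  assumes "infinite (UNIV :: 'a set)"
  shows "\<exists>(G :: 'a monoid) e. admissible TYPE('a) G e 5"
proof -
  interpret L: group lamp_group by (rule group_lamp_group)
  define H where "H = generate lamp_group (range lamp_marking)"
  have rng: "range lamp_marking \<subseteq> H" unfolding H_def by (rule subsetI) (rule generate.incl)
  have H: "subgroup H lamp_group"
    unfolding H_def using marking_lamp_group by (intro L.generate_is_subgroup) (simp add: marking_def)
  define P where "P = lamp_group\<lparr>carrier := H\<rparr>"
  interpret P: group P unfolding P_def using L.subgroup_imp_group[OF H] .
  define s :: "(int \<Rightarrow> bool) \<times> bool \<times> int \<Rightarrow> bool" where "s = (\<lambda>(f, s, i). s)"
  have s_mult: "s (g \<otimes>\<^bsub>lamp_group\<^esub> h) \<longleftrightarrow> s g \<noteq> s h" for g h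
    by (cases g; cases h) (auto simp: s_def)
  \<comment> \<open>The orientation-preserving elements form the lamplighter part. It contains
    \<open>Ld\<close> and the translation \<open>La Lc\<close>, and its growth passes to
    \<open>P\<close> by the index two lemma with \<open>\<phi>\<close> the identity.\<close>
  define K where "K = {g \<in> H. \<not> s g}"
  have "subgroup K P" using P.subgroup_index_two[of s] s_mult by (simp add: K_def P_def)
  hence K: "subgroup K lamp_group" unfolding P_def by (rule L.incl_subgroup[OF H])
  have ue: "uniformly_exponential (lamp_group\<lparr>carrier := K\<rparr>)"
  proof (rule uniformly_exponential_lamplighter[OF K])
    have "lamp_marking Ld \<in> H" using rng by blast
    thus "lamp_marking Ld \<in> K" by (simp add: K_def s_def)
    have "lamp_marking La \<otimes>\<^bsub>lamp_group\<^esub> lamp_marking Lc \<in> H" using rng subgroup.m_closed[OF H] by blast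
    thus "(\<lambda>_. False, False, 1) \<in> K" by (simp add: K_def s_def reflect_def)
  qed (auto simp: K_def s_def)
  have "marking P lamp_marking"
    using marking_lamp_group rng P.is_group by (simp add: marking_def P_def)
  moreover have "generate P (range lamp_marking) = carrier P"
    unfolding P_def using L.generate_consistent[OF rng H] by (simp add: H_def)
  moreover have "uniformly_exponential P"
  proof (rule P.uniformly_exponential_index_two[of "lamp_group\<lparr>carrier := K\<rparr>" s K id])
    show "group (lamp_group\<lparr>carrier := K\<rparr>)" using L.subgroup_imp_group[OF K] .
    show "id \<in> hom (P\<lparr>carrier := K\<rparr>) (lamp_group\<lparr>carrier := K\<rparr>)" by (auto simp: hom_def P_def)
  qed (use ue s_mult in \<open>auto simp: K_def P_def\<close>)
  moreover have "elementary_amenable_copy TYPE('a) P"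
    unfolding P_def
    using elementary_amenable_copy_subgroup[OF elementary_amenable_copy_lamp_group(2)[OF assms] L.is_group H] .
  ultimately have "admissible TYPE('a) P lamp_marking 5"
    using growth_bounded_5 by (simp add: admissible_def)
  moreover obtain f :: "(int \<Rightarrow> bool) \<times> bool \<times> int \<Rightarrow> 'a" where "inj_on f (carrier lamp_group)"
    using elementary_amenable_copy_lamp_group(1)[OF assms] by blast
  hence "inj_on f (carrier P)"
    using subgroup.subset[OF H] by (auto simp: P_def intro: inj_on_subset)
  ultimately show ?thesis using admissible_image_group by blast
qed

lemma admissible_small:
  assumes "infinite (UNIV :: 'a set)"
  shows "\<exists>(G :: 'a monoid) e. admissible TYPE('a) G e (5 powr ((9 / 10) ^ n))"
proof (induction n)
  case 0
  then show ?case using admissible_lamp_group[OF assms] by simp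
next
  case (Suc n)
  then obtain G :: "'a monoid" and e where "admissible TYPE('a) G e (5 powr ((9 / 10) ^ n))" by blast
  moreover have "(1::real) < 5 powr ((9 / 10) ^ n)" by simp
  ultimately have "\<exists>(H :: 'a monoid) e'. admissible TYPE('a) H e' ((5 powr ((9 / 10) ^ n)) powr (9 / 10))"
    by (rule admissible_step[OF assms])
  thus ?case by (simp add: powr_powr mult.commute)
qed

text \<open>The exponent 4 is the largest weight of a letter: a word of length \<open>n\<close>
  weighs at most \<open>4 * n\<close>.\<close>

lemma admissible_minimal_growth_rate:
  assumes adm: "admissible T G e r" and r: "0 < r"
  shows "finitely_generated_group G" "1 < minimal_growth_rate G" "minimal_growth_rate G \<le> r ^ 4"
proof -
  have e: "marking G e" using adm by (simp add: admissible_def)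
  interpret group G using e by (rule marking_group)
  have gen: "finite_generating_set G (range e)"
    using adm marking_closed[OF e] unfolding finite_generating_set_def admissible_def
    by (auto simp: UNIV_letter)
  thus fg: "finitely_generated_group G" using is_group by (auto simp: finitely_generated_group_def)
  show "1 < minimal_growth_rate G"
    using minimal_growth_rate_gt_1[OF fg] adm by (simp add: admissible_def)
  obtain C where C: "0 < C" "\<And>n. real (card (weighted_ball G e n)) \<le> C * r ^ n"
    using adm by (auto simp: admissible_def growth_bounded_def)
  have "growth_rate G (range e) \<le> r ^ 4"
  proof (rule growth_rate_upper_bound[OF gen C(1)])
    fix n
    have "card (word_ball G (range e) n) \<le> card (weighted_ball G e (4 * n))"
      by (rule card_mono[OF finite_weighted_ball word_ball_subset_weighted_ball[OF e]])
    thus "real (card (word_ball G (range e) n)) \<le> C * (r ^ 4) ^ n"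
      using C(2)[of "4 * n"] by (simp add: power_mult)
  qed (use r in simp)
  thus "minimal_growth_rate G \<le> r ^ 4" using minimal_growth_rate_le[OF is_group gen] by linarith
qed

theorem theorem2p3:
  assumes "infinite (UNIV :: 'a set)"
  shows "EG_growth_rates TYPE('a) \<subseteq> {1..} \<and> (1::real) islimpt EG_growth_rates TYPE('a)"
proof
  show "EG_growth_rates TYPE('a) \<subseteq> {1..}"
    using minimal_growth_rate_ge_1 by (auto simp: EG_growth_rates_def)
  show "(1::real) islimpt EG_growth_rates TYPE('a)"
    unfolding islimpt_approachable
  proof (intro allI impI)
    fix \<epsilon> :: real assume \<epsilon>: "0 < \<epsilon>"
    have "(\<lambda>n. (9 / 10 :: real) ^ n) \<longlonglongrightarrow> 0" by (rule LIMSEQ_realpow_zero) auto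
    \<comment> \<open>The upper bounds for the minimal rates tend to 1, while each rate exceeds 1,
      so points of the set other than 1 come arbitrarily close to 1.\<close>
    hence "(\<lambda>n. ((5::real) powr ((9 / 10) ^ n)) ^ 4) \<longlonglongrightarrow> (5 powr 0) ^ 4"
      by (intro tendsto_power tendsto_powr tendsto_const) auto
    hence "\<forall>\<^sub>F n in sequentially. ((5::real) powr ((9 / 10) ^ n)) ^ 4 < 1 + \<epsilon>"
      using \<epsilon> by (intro order_tendstoD(2)) auto
    then obtain n where n: "((5::real) powr ((9 / 10) ^ n)) ^ 4 < 1 + \<epsilon>"
      by (auto simp: eventually_sequentially)
    obtain G :: "'a monoid" and e where G: "admissible TYPE('a) G e (5 powr ((9 / 10) ^ n))"
      using admissible_small[OF assms] by blast
    note rate = admissible_minimal_growth_rate[OF G]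
    have "group G" using G by (auto simp: admissible_def marking_def)
    moreover have "elementary_amenable_copy TYPE('a) G" using G by (simp add: admissible_def)
    ultimately have "elementary_amenable G" using elementary_amenable_of_copy iso_refl by blast
    hence "minimal_growth_rate G \<in> EG_growth_rates TYPE('a)"
      using rate(1) by (auto simp: EG_growth_rates_def)
    moreover have "minimal_growth_rate G \<noteq> 1" "dist (minimal_growth_rate G) 1 < \<epsilon>"
      using rate n by (auto simp: dist_real_def)
    ultimately show "\<exists>x'\<in>EG_growth_rates TYPE('a). x' \<noteq> 1 \<and> dist x' 1 < \<epsilon>" by blast
  qed
qed

end
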